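(* Let $\Phi$ be a quantum channel acting on a system $A$ with Hilbert space of dimension $d$. Then the complete decohering power of $\Phi$ with respect to the relative entropy of coherence satisfies $$\mathfrak{D}_r(\Phi)\le 2\log_2 d.$$ Moreover, if the initial states are restricted to be separable, then $$\sup_{k}\ \max_{\rho^{AB}_{\mathrm{sep}}}\left\{C_r\left(\rho^{AB}_{\mathrm{sep}}\right)-C_r\left(\Phi\otimes\mathbb{1}_k\left[\rho^{AB}_{\mathrm{sep}}\right]\right)\right\}\le\log_2 d,$$ where, for each integer $k\ge1$, the maximum is over all separable states $\rho^{AB}_{\mathrm{sep}}$ of $A\otimes B$ with $\dim B=k$.
   Context: All Hilbert spaces are finite-dimensional complex, and each system has a fixed orthonormal reference basis $\{|i\rangle\}$; for a bipartite system the reference basis is the product of the local reference bases. A state is a positive semidefinite operator of trace one; a quantum channel is a completely positive trace-preserving linear map. A bipartite state is separable if it is a convex combination of product states $\rho^A\otimes\rho^B$. $S(\rho)=-\mathrm{Tr}[\rho\log_2\rho]$ is the von Neumann entropy and $\Delta[\rho]=\sum_i\langle i|\rho|i\rangle\,|i\rangle\langle i|$ is complete dephasing in the reference basis. The relative entropy of coherence is $$C_r(\rho)=\min_{\sigma\in\mathcal{I}}S(\rho\|\sigma)=S(\Delta[\rho])-S(\rho),$$ where $\mathcal{I}$ is the set of states diagonal in the reference basis and $S(\rho\|\sigma)=\mathrm{Tr}[\rho\log_2\rho]-\mathrm{Tr}[\rho\log_2\sigma]$. $\mathbb{1}_k$ denotes the identity channel on a system $B$ of dimension $k$. The complete decohering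 power is $$\mathfrak{D}_r(\Phi)=\sup_{k}\ \sup_{\rho^{AB}}\left\{C_r(\rho^{AB})-C_r\left(\Phi\otimes\mathbb{1}_k[\rho^{AB}]\right)\right\},$$ with $\rho^{AB}$ ranging over all states of $A\otimes B$, $\dim B=k$. *)

theory Defs
  imports
    "Jordan_Normal_Form.Schur_Decomposition"
    "Jordan_Normal_Form.Matrix_Kernel"
    "HOL-Library.Extended_Real"
begin

text \<open>
  A system of dimension \<open>n\<close> is represented by complex \<open>n \<times> n\<close> matrices, written in the reference
  basis.  For a bipartite system of local dimensions \<open>d\<close> and \<open>k\<close>, the product basis vector
  \<open>|i\<rangle>|j\<rangle>\<close> has index \<open>i * k + j\<close>.
\<close>

subsection \<open>States\<close>

definition mat_trace :: "complex mat \<Rightarrow> complex" where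
  "mat_trace A = (\<Sum>i<dim_row A. A $$ (i, i))"

text \<open>
  In the order on \<^typ>\<open>complex\<close> used here, \<open>0 \<le> z\<close> means that \<open>z\<close> is real and nonnegative.
\<close>

definition psd :: "nat \<Rightarrow> complex mat \<Rightarrow> bool" where
  "psd n A \<longleftrightarrow> A \<in> carrier_mat n n \<and> (\<forall>v \<in> carrier_vec n. 0 \<le> (A *\<^sub>v v) \<bullet>c v)"

definition states :: "nat \<Rightarrow> complex mat set" where
  "states n = {\<rho>. psd n \<rho> \<and> mat_trace \<rho> = 1}"

definition incoherent_states :: "nat \<Rightarrow> complex mat set" where
  "incoherent_states n = {\<sigma> \<in> states n. diagonal_mat \<sigma>}"

definition dephasing :: "complex mat \<Rightarrow> complex mat" where
  "dephasing \<rho> = mat_diag (dim_row \<rho>) (\<lambda>i. \<rho> $$ (i, i))"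

definition tensor_mat :: "complex mat \<Rightarrow> complex mat \<Rightarrow> complex mat" where
  "tensor_mat A B = mat (dim_row A * dim_row B) (dim_col A * dim_col B)
     (\<lambda>(a, b). A $$ (a div dim_row B, b div dim_col B) * B $$ (a mod dim_row B, b mod dim_col B))"

definition separable_states :: "nat \<Rightarrow> nat \<Rightarrow> complex mat set" where
  "separable_states d k = {\<rho>. \<exists>(m::nat) (p :: nat \<Rightarrow> real) R T.
     (\<forall>l<m. 0 \<le> p l \<and> R l \<in> states d \<and> T l \<in> states k) \<and> (\<Sum>l<m. p l) = 1 \<and>
     \<rho> = mat (d * k) (d * k) (\<lambda>ij. \<Sum>l<m. complex_of_real (p l) * tensor_mat (R l) (T l) $$ ij)}"


subsection \<open>Channels\<close>

text \<open>
  \<open>\<Phi> \<otimes> \<one>\<^sub>k\<close>: the map \<open>\<Phi>\<close> is applied to each of the \<open>d \<times> d\<close> matrices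
  \<open>(\<langle>i|\<langle>r| X |j\<rangle>|s\<rangle>)\<^sub>i\<^sub>j\<close> with \<open>r\<close>, \<open>s\<close> fixed.
\<close>

definition ext_id :: "nat \<Rightarrow> nat \<Rightarrow> (complex mat \<Rightarrow> complex mat) \<Rightarrow> complex mat \<Rightarrow> complex mat" where
  "ext_id d k \<Phi> X = mat (d * k) (d * k)
     (\<lambda>(a, b). \<Phi> (mat d d (\<lambda>(i, j). X $$ (i * k + a mod k, j * k + b mod k))) $$ (a div k, b div k))"

definition linear_on_mats :: "nat \<Rightarrow> (complex mat \<Rightarrow> complex mat) \<Rightarrow> bool" where
  "linear_on_mats d \<Phi> \<longleftrightarrow>
     (\<forall>X \<in> carrier_mat d d. \<Phi> X \<in> carrier_mat d d) \<and>
     (\<forall>X \<in> carrier_mat d d. \<forall>Y \<in> carrier_mat d d. \<Phi> (X + Y) = \<Phi> X + \<Phi> Y) \<and>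
     (\<forall>c. \<forall>X \<in> carrier_mat d d. \<Phi> (c \<cdot>\<^sub>m X) = c \<cdot>\<^sub>m \<Phi> X)"

definition completely_positive :: "nat \<Rightarrow> (complex mat \<Rightarrow> complex mat) \<Rightarrow> bool" where
  "completely_positive d \<Phi> \<longleftrightarrow> (\<forall>k\<ge>1. \<forall>X. psd (d * k) X \<longrightarrow> psd (d * k) (ext_id d k \<Phi> X))"

definition trace_preserving :: "nat \<Rightarrow> (complex mat \<Rightarrow> complex mat) \<Rightarrow> bool" where
  "trace_preserving d \<Phi> \<longleftrightarrow> (\<forall>X \<in> carrier_mat d d. mat_trace (\<Phi> X) = mat_trace X)"

definition quantum_channel :: "nat \<Rightarrow> (complex mat \<Rightarrow> complex mat) \<Rightarrow> bool" where
  "quantum_channel d \<Phi> \<longleftrightarrow> linear_on_mats d \<Phi> \<and> completely_positive d \<Phi> \<and> trace_preserving d \<Phi>"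


subsection \<open>Entropies and coherence\<close>

text \<open>
  Functional calculus: \<open>mat_fun f A = U diag(f e\<^sub>0, \<dots>, f e\<^sub>n\<^sub>-\<^sub>1) U\<^sup>*\<close> whenever
  \<open>A = U diag(e\<^sub>0, \<dots>, e\<^sub>n\<^sub>-\<^sub>1) U\<^sup>*\<close> with \<open>U\<close> unitary and the \<open>e\<^sub>i\<close> real.
  The result does not depend on the decomposition, see \<open>mat_fun_eqI\<close> below.
\<close>

definition diagonalizes :: "complex mat \<Rightarrow> (nat \<Rightarrow> real) \<Rightarrow> complex mat \<Rightarrow> bool" where
  "diagonalizes U e A \<longleftrightarrow> (let n = dim_row A in
     A \<in> carrier_mat n n \<and> U \<in> carrier_mat n n \<and>
     U * mat_adjoint U = 1\<^sub>m n \<and> mat_adjoint U * U = 1\<^sub>m n \<and>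
     A = U * mat_diag n (\<lambda>i. complex_of_real (e i)) * mat_adjoint U)"

definition mat_fun :: "(real \<Rightarrow> real) \<Rightarrow> complex mat \<Rightarrow> complex mat" where
  "mat_fun f A = (THE B. \<exists>U e. diagonalizes U e A \<and>
     B = U * mat_diag (dim_row A) (\<lambda>i. complex_of_real (f (e i))) * mat_adjoint U)"

text \<open>
  \<^term>\<open>log 2 0 = (0::real)\<close>.  This value is immaterial below: in \<open>Tr[\<rho> log \<sigma>]\<close> the
  kernel of \<open>\<sigma>\<close> does not contribute once it is contained in the kernel of \<open>\<rho>\<close>.
\<close>

definition mat_log2 :: "complex mat \<Rightarrow> complex mat" where
  "mat_log2 = mat_fun (log 2)"

definition vn_entropy :: "complex mat \<Rightarrow> real" where
  "vn_entropy \<rho> = - Re (mat_trace (\<rho> * mat_log2 \<rho>))"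

text \<open>The value is \<open>\<infinity>\<close> unless the support of \<open>\<rho>\<close> is contained in that of \<open>\<sigma>\<close>.\<close>

definition relative_entropy :: "complex mat \<Rightarrow> complex mat \<Rightarrow> ereal" where
  "relative_entropy \<rho> \<sigma> =
     (if mat_kernel \<sigma> \<subseteq> mat_kernel \<rho>
      then ereal (Re (mat_trace (\<rho> * mat_log2 \<rho>)) - Re (mat_trace (\<rho> * mat_log2 \<sigma>)))
      else \<infinity>)"

definition rel_ent_coherence :: "complex mat \<Rightarrow> ereal" where
  "rel_ent_coherence \<rho> = (INF \<sigma> \<in> incoherent_states (dim_row \<rho>). relative_entropy \<rho> \<sigma>)"

definition coherence_loss :: "nat \<Rightarrow> nat \<Rightarrow> (complex mat \<Rightarrow> complex mat) \<Rightarrow> complex mat \<Rightarrow> ereal" where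
  "coherence_loss d k \<Phi> \<rho> = rel_ent_coherence \<rho> - rel_ent_coherence (ext_id d k \<Phi> \<rho>)"

definition complete_decohering_power :: "nat \<Rightarrow> (complex mat \<Rightarrow> complex mat) \<Rightarrow> ereal" where
  "complete_decohering_power d \<Phi> = (SUP k \<in> {1..}. SUP \<rho> \<in> states (d * k). coherence_loss d k \<Phi> \<rho>)"


subsection \<open>Consistency of the definitions\<close>

lemma ext_id_tensor_mat:
  assumes lin: "linear_on_mats d \<Phi>" and X: "X \<in> carrier_mat d d" and Y: "Y \<in> carrier_mat k k"
  shows "ext_id d k \<Phi> (tensor_mat X Y) = tensor_mat (\<Phi> X) Y"
proof -
  have c: "\<Phi> X \<in> carrier_mat d d" using lin X by (auto simp: linear_on_mats_def)
  show ?thesis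
  proof (rule eq_matI)
    fix a b assume "a < dim_row (tensor_mat (\<Phi> X) Y)" "b < dim_col (tensor_mat (\<Phi> X) Y)"
    then have ab: "a < d * k" "b < d * k" using c Y by (auto simp: tensor_mat_def)
    then have k: "k > 0" by (cases k) auto
    have dv: "a div k < d" "b div k < d" using ab k by (auto simp: less_mult_imp_div_less)
    have md: "a mod k < k" "b mod k < k" using k by auto
    have lt: "i * k + r < d * k" if "i < d" "r < k" for i r
    proof -
      have "i * k + r < (i + 1) * k" using that by simp
      also have "\<dots> \<le> d * k" using that by (intro mult_le_mono1) simp
      finally show ?thesis .
    qed
    have "mat d d (\<lambda>(i, j). tensor_mat X Y $$ (i * k + a mod k, j * k + b mod k))
        = Y $$ (a mod k, b mod k) \<cdot>\<^sub>m X" (is "?M = _")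
      using X Y md k by (intro eq_matI) (auto simp: tensor_mat_def lt)
    then have "\<Phi> ?M = Y $$ (a mod k, b mod k) \<cdot>\<^sub>m \<Phi> X"
      using lin X by (auto simp: linear_on_mats_def)
    then show "ext_id d k \<Phi> (tensor_mat X Y) $$ (a, b) = tensor_mat (\<Phi> X) Y $$ (a, b)"
      using ab dv c Y by (simp add: ext_id_def tensor_mat_def)
  qed (use c Y in \<open>auto simp: ext_id_def tensor_mat_def\<close>)
qed

lemma mat_adjoint_carrier [simp]: "U \<in> carrier_mat n n \<Longrightarrow> mat_adjoint U \<in> carrier_mat n n"
  by (auto simp: mat_adjoint_def)

lemma mat_fun_eqI:
  assumes "diagonalizes U e A"
  shows "mat_fun f A = U * mat_diag (dim_row A) (\<lambda>i. complex_of_real (f (e i))) * mat_adjoint U"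
proof -
  define n where "n = dim_row A"
  define D where "D e = mat_diag n (\<lambda>i. complex_of_real (e i))" for e :: "nat \<Rightarrow> real"
  have D: "D e \<in> carrier_mat n n" for e by (simp add: D_def)
  have eq: "V * D (\<lambda>i. f (g i)) * mat_adjoint V = U * D (\<lambda>i. f (e i)) * mat_adjoint U"
    if V: "diagonalizes V g A" for V g
  proof -
    let ?Ua = "mat_adjoint U" and ?Va = "mat_adjoint V"
    have cU: "U \<in> carrier_mat n n" "?Ua \<in> carrier_mat n n"
      and cV: "V \<in> carrier_mat n n" "?Va \<in> carrier_mat n n"
      and uU: "?Ua * U = 1\<^sub>m n" "U * ?Ua = 1\<^sub>m n"
      and uV: "?Va * V = 1\<^sub>m n" "V * ?Va = 1\<^sub>m n"
      and AU: "A = U * D e * ?Ua" and AV: "A = V * D g * ?Va"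
      using assms V by (auto simp: diagonalizes_def Let_def n_def D_def)
    note as = assoc_mult_mat[of _ n n _ n _ n] mult_carrier_mat[of _ n n _ n]
    define W where "W = ?Va * U"
    have W: "W \<in> carrier_mat n n" unfolding W_def by (rule mult_carrier_mat[OF cV(2) cU(1)])
    have sand: "?Va * (X * Y * ?Ua) * U = ?Va * X * Y"
      if "X \<in> carrier_mat n n" "Y \<in> carrier_mat n n" for X Y
      using that cU cV uU by (simp add: as)
    have sand': "?Va * (V * Y * ?Va) * U = Y * W" if "Y \<in> carrier_mat n n" for Y
    proof -
      have "?Va * (V * Y * ?Va) * U = (?Va * V) * (Y * (?Va * U))"
        using that cU cV by (simp add: as)
      then show ?thesis using that W uV by (simp add: W_def[symmetric])
    qed
    have comm: "W * D e = D g * W"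
      using sand[OF cU(1) D[of e]] sand'[OF D[of g]] AU AV by (simp add: W_def)
    have ent: "W $$ (i, j) * complex_of_real (e j) = complex_of_real (g i) * W $$ (i, j)"
      if "i < n" "j < n" for i j
      using arg_cong[OF comm, of "\<lambda>M. M $$ (i, j)"] that
      by (simp add: D_def mat_diag_mult_right[OF W] mat_diag_mult_left[OF W])
    have "W * D (\<lambda>i. f (e i)) = D (\<lambda>i. f (g i)) * W"
    proof (rule eq_matI)
      fix i j assume "i < dim_row (D (\<lambda>i. f (g i)) * W)" "j < dim_col (D (\<lambda>i. f (g i)) * W)"
      then have ij: "i < n" "j < n" using W D[of "\<lambda>i. f (g i)"] by auto
      show "(W * D (\<lambda>i. f (e i))) $$ (i, j) = (D (\<lambda>i. f (g i)) * W) $$ (i, j)"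
        using ent[OF ij] ij
        by (cases "W $$ (i, j) = 0")
          (auto simp: D_def mat_diag_mult_right[OF W] mat_diag_mult_left[OF W] mult.commute)
    qed (use W D[of "\<lambda>i. f (e i)"] D[of "\<lambda>i. f (g i)"] in auto)
    then have "V * (W * D (\<lambda>i. f (e i))) * ?Ua = V * (D (\<lambda>i. f (g i)) * W) * ?Ua" by simp
    moreover have "V * (W * D h) * ?Ua = U * D h * ?Ua" for h
    proof -
      have "V * (W * D h) = (V * ?Va) * (U * D h)"
        unfolding W_def using cU cV D[of h] by (simp add: as)
      then show ?thesis using uV cU D[of h] by simp
    qed
    moreover have "V * (D h * W) * ?Ua = V * D h * ?Va" for h
    proof -
      have "V * (D h * W) * ?Ua = V * D h * ?Va * (U * ?Ua)"
        unfolding W_def using cU cV D[of h] by (simp add: as)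
      moreover have "V * D h * ?Va \<in> carrier_mat n n" using cV D[of h] by (simp add: as)
      ultimately show ?thesis using uU by (metis right_mult_one_mat)
    qed
    ultimately show ?thesis by simp
  qed
  show ?thesis
    unfolding mat_fun_def n_def[symmetric] D_def[symmetric]
  proof (rule the_equality)
    show "\<exists>V g. diagonalizes V g A \<and>
      U * D (\<lambda>i. f (e i)) * mat_adjoint U = V * D (\<lambda>i. f (g i)) * mat_adjoint V"
      using assms by blast
  next
    fix B assume "\<exists>V g. diagonalizes V g A \<and> B = V * D (\<lambda>i. f (g i)) * mat_adjoint V"
    then show "B = U * D (\<lambda>i. f (e i)) * mat_adjoint U" by (elim exE conjE) (simp only: eq)
  qed
qed

lemma mat_fun_diag:
  "mat_fun f (mat_diag n (\<lambda>i. complex_of_real (e i))) = mat_diag n (\<lambda>i. complex_of_real (f (e i)))"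
proof -
  let ?A = "mat_diag n (\<lambda>i. complex_of_real (e i))"
  have adj: "mat_adjoint (1\<^sub>m n :: complex mat) = 1\<^sub>m n"
    by (rule eq_matI) (auto simp: mat_adjoint_def mat_of_rows_def)
  have dim: "dim_row ?A = n" by (simp add: mat_diag_def)
  have mm: "1\<^sub>m n * mat_diag n h = mat_diag n h" "mat_diag n h * 1\<^sub>m n = mat_diag n h"
    for h :: "nat \<Rightarrow> complex"
    by (rule left_mult_one_mat[OF mat_diag_dim] right_mult_one_mat[OF mat_diag_dim])+
  have "diagonalizes (1\<^sub>m n) e ?A"
    by (simp add: diagonalizes_def dim adj mm)
  from mat_fun_eqI[OF this, of f] show ?thesis by (simp add: dim adj mm)
qed

lemma mat_diag_mult_vec:
  "v \<in> carrier_vec n \<Longrightarrow> mat_diag n h *\<^sub>v v = vec n (\<lambda>i. h i * v $ i)"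
  for h :: "nat \<Rightarrow> complex"
  by (rule eq_vecI)
    (auto simp: mat_diag_def scalar_prod_def if_distrib if_distribR cong: if_cong)

lemma psd_quad_form:
  assumes "psd n A" and "finite S" "S \<subseteq> {..<n}" and "\<And>i. i \<notin> S \<Longrightarrow> x i = 0"
  shows "0 \<le> (\<Sum>i\<in>S. \<Sum>j\<in>S. A $$ (i, j) * x j * cnj (x i))"
proof -
  let ?v = "vec n x"
  have A: "A \<in> carrier_mat n n" using assms by (simp add: psd_def)
  have "0 \<le> (A *\<^sub>v ?v) \<bullet>c ?v" using assms(1) unfolding psd_def by simp
  also have "(A *\<^sub>v ?v) \<bullet>c ?v = (\<Sum>i<n. \<Sum>j<n. A $$ (i, j) * x j * cnj (x i))"
    using A by (simp add: scalar_prod_def mult_mat_vec_def sum_distrib_right atLeast0LessThan)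
  also have "\<dots> = (\<Sum>i\<in>S. \<Sum>j<n. A $$ (i, j) * x j * cnj (x i))"
    using assms by (intro sum.mono_neutral_right) auto
  also have "\<dots> = (\<Sum>i\<in>S. \<Sum>j\<in>S. A $$ (i, j) * x j * cnj (x i))"
    using assms by (intro sum.cong sum.mono_neutral_right) auto
  finally show ?thesis .
qed

lemma psd_diag_nonneg: "psd n A \<Longrightarrow> i < n \<Longrightarrow> 0 \<le> A $$ (i, i)"
  using psd_quad_form[of n A "{i}" "\<lambda>j. if j = i then 1 else 0"] by simp

lemma psd_diag_zero:
  assumes A: "psd n A" and i: "i < n" and j: "j < n" and z: "A $$ (i, i) = 0"
  shows "A $$ (j, i) = 0"
proof (cases "i = j")
  case False
  define b c p where "b = A $$ (i, j)" and "c = A $$ (j, i)" and "p = A $$ (j, j)"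
  have *: "0 \<le> b * cnj t + c * t + p" for t
  proof -
    have "0 \<le> (\<Sum>a\<in>{i, j}. \<Sum>d\<in>{i, j}. A $$ (a, d) * (if d = i then t else if d = j then 1 else 0)
        * cnj (if a = i then t else if a = j then 1 else 0))"
      using i j by (intro psd_quad_form[OF A]) auto
    then show ?thesis using False z by (simp add: b_def c_def p_def algebra_simps)
  qed
  have p: "Im p = 0" using psd_diag_nonneg[OF A j] by (simp add: p_def less_eq_complex_def)
  have "Im b + Im c = 0" using *[of 1] p by (simp add: less_eq_complex_def)
  moreover have "Re b = Re c" using *[of \<i>] p by (simp add: less_eq_complex_def)
  ultimately have b: "b = cnj c" by (simp add: complex_eq_iff)
  define N where "N = (Re c)\<^sup>2 + (Im c)\<^sup>2"
  have N: "2 * s * N \<le> Re p" for s :: real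
    using *[of "- complex_of_real s * cnj c"] b
    by (simp add: N_def less_eq_complex_def algebra_simps power2_eq_square)
  have "N = 0" using N[of "(Re p + 1) / (2 * N)"] by (cases "N = 0") simp_all
  then have "c = 0" by (simp add: N_def complex_eq_iff)
  then show ?thesis by (simp add: c_def)
qed (use z in simp)

lemma gibbs_term:
  assumes "0 \<le> p" "0 \<le> q" "q = 0 \<longrightarrow> p = (0::real)"
  shows "(p - q) / ln 2 \<le> p * log 2 p - p * log 2 q"
proof (cases "p = 0")
  case False
  then have p: "p > 0" and q: "q > 0" using assms by auto
  have "ln (q / p) \<le> q / p - 1" using p q by (intro ln_le_minus_one) auto
  then have "p * (ln q - ln p) \<le> p * (q / p - 1)"
    using p q by (intro mult_left_mono) (auto simp: ln_div)
  then have "p - q \<le> p * ln p - p * ln q" using p by (simp add: algebra_simps)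
  then have "(p - q) / ln 2 \<le> (p * ln p - p * ln q) / ln 2" by (intro divide_right_mono) auto
  then show ?thesis by (simp add: log_def diff_divide_distrib)
qed (use assms in \<open>auto simp: divide_nonpos_pos\<close>)

text \<open>The closed form of the relative entropy of coherence.\<close>

theorem rel_ent_coherence_eq:
  assumes \<rho>: "\<rho> \<in> states n"
  shows "rel_ent_coherence \<rho> = ereal (vn_entropy (dephasing \<rho>) - vn_entropy \<rho>)"
proof -
  have psd: "psd n \<rho>" and tr: "mat_trace \<rho> = 1" and c: "\<rho> \<in> carrier_mat n n"
    using \<rho> by (auto simp: states_def psd_def)
  have dim: "dim_row \<rho> = n" using c by simp
  define p where "p i = Re (\<rho> $$ (i, i))" for i
  have p0: "0 \<le> p i" if "i < n" for i
    using psd_diag_nonneg[OF psd that] by (simp add: p_def less_eq_complex_def)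
  have pc: "\<rho> $$ (i, i) = complex_of_real (p i)" if "i < n" for i
    using psd_diag_nonneg[OF psd that] by (simp add: p_def less_eq_complex_def complex_eq_iff)
  have p1: "(\<Sum>i<n. p i) = 1"
    using arg_cong[OF tr, of Re] by (simp add: mat_trace_def dim p_def)
  have trd: "Re (mat_trace (\<rho> * mat_diag n (\<lambda>i. complex_of_real (g i)))) = (\<Sum>i<n. p i * g i)" for g
    by (simp add: mat_diag_mult_right[OF c] mat_trace_def p_def)
  have dephD: "dephasing \<rho> = mat_diag n (\<lambda>i. complex_of_real (p i))"
    unfolding dephasing_def dim by (rule eq_matI) (auto simp: mat_diag_def pc)
  have logD: "mat_log2 (dephasing \<rho>) = mat_diag n (\<lambda>i. complex_of_real (log 2 (p i)))"
    by (simp add: mat_log2_def dephD mat_fun_diag)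
  have SD: "vn_entropy (dephasing \<rho>) = - (\<Sum>i<n. p i * log 2 (p i))"
    unfolding vn_entropy_def logD unfolding dephD mat_diag_diag
    by (simp add: mat_trace_def mat_diag_def)
  have dmem: "dephasing \<rho> \<in> incoherent_states n"
  proof -
    have "psd n (dephasing \<rho>)"
      unfolding psd_def
    proof (intro conjI ballI)
      show "dephasing \<rho> \<in> carrier_mat n n" by (simp add: dephD)
      fix v :: "complex vec" assume v: "v \<in> carrier_vec n"
      have "(dephasing \<rho> *\<^sub>v v) \<bullet>c v = (\<Sum>i<n. complex_of_real (p i) * (v $ i * cnj (v $ i)))"
        using v
        by (simp add: dephD mat_diag_mult_vec scalar_prod_def atLeast0LessThan mult.assoc)
      also have "0 \<le> \<dots>"
        using p0 by (intro sum_nonneg) (auto simp: less_eq_complex_def complex_mult_cnj)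
      finally show "0 \<le> (dephasing \<rho> *\<^sub>v v) \<bullet>c v" .
    qed
    moreover have "mat_trace (dephasing \<rho>) = 1"
      using p1 by (simp add: mat_trace_def dephD mat_diag_def flip: of_real_sum)
    ultimately show ?thesis
      by (auto simp: incoherent_states_def states_def diagonal_mat_def dephD mat_diag_def)
  qed
  have kd: "mat_kernel (dephasing \<rho>) \<subseteq> mat_kernel \<rho>"
  proof
    fix v assume "v \<in> mat_kernel (dephasing \<rho>)"
    then have v: "v \<in> carrier_vec n" and z: "dephasing \<rho> *\<^sub>v v = 0\<^sub>v n"
      by (auto simp: mat_kernel_def dephD mat_diag_def)
    have "complex_of_real (p i) * v $ i = 0" if "i < n" for i
      using arg_cong[OF z, of "\<lambda>w. w $ i"] that v
      by (simp add: dephD mat_diag_mult_vec)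
    then have "\<rho> $$ (j, i) * v $ i = 0" if "i < n" "j < n" for i j
      using psd_diag_zero[OF psd that] pc[OF that(1)] that by fastforce
    then have "\<rho> *\<^sub>v v = 0\<^sub>v n"
      using c v by (intro eq_vecI) (auto simp: scalar_prod_def intro!: sum.neutral)
    then show "v \<in> mat_kernel \<rho>" using c v by (auto simp: mat_kernel_def)
  qed
  have att: "relative_entropy \<rho> (dephasing \<rho>) = ereal (vn_entropy (dephasing \<rho>) - vn_entropy \<rho>)"
    using kd by (simp add: relative_entropy_def logD trd SD vn_entropy_def[of \<rho>])
  have low: "ereal (vn_entropy (dephasing \<rho>) - vn_entropy \<rho>) \<le> relative_entropy \<rho> \<sigma>"
    if "\<sigma> \<in> incoherent_states n" for \<sigma>
  proof (cases "mat_kernel \<sigma> \<subseteq> mat_kernel \<rho>")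
    case True
    have \<sigma>: "psd n \<sigma>" "mat_trace \<sigma> = 1" "\<sigma> \<in> carrier_mat n n" "diagonal_mat \<sigma>"
      using that by (auto simp: incoherent_states_def states_def psd_def)
    define q where "q i = Re (\<sigma> $$ (i, i))" for i
    have q0: "0 \<le> q i" and qc: "\<sigma> $$ (i, i) = complex_of_real (q i)" if "i < n" for i
      using psd_diag_nonneg[OF \<sigma>(1) that]
      by (auto simp: q_def less_eq_complex_def complex_eq_iff)
    have q1: "(\<Sum>i<n. q i) = 1"
      using arg_cong[OF \<sigma>(2), of Re] \<sigma>(3) by (simp add: mat_trace_def q_def)
    have sD: "\<sigma> = mat_diag n (\<lambda>i. complex_of_real (q i))"
      using \<sigma> by (intro eq_matI) (auto simp: mat_diag_def qc diagonal_mat_def)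
    have logs: "mat_log2 \<sigma> = mat_diag n (\<lambda>i. complex_of_real (log 2 (q i)))"
      by (subst sD) (simp add: mat_log2_def mat_fun_diag)
    have qp: "q i = 0 \<longrightarrow> p i = 0" if i: "i < n" for i
    proof
      assume "q i = 0"
      then have "\<sigma> *\<^sub>v unit_vec n i = 0\<^sub>v n"
        using i by (subst sD, intro eq_vecI) (auto simp: mat_diag_def)
      then have "unit_vec n i \<in> mat_kernel \<sigma>"
        by (rule mat_kernelI[OF \<sigma>(3) unit_vec_carrier])
      then have "unit_vec n i \<in> mat_kernel \<rho>" by (rule subsetD[OF True])
      then have "\<rho> *\<^sub>v unit_vec n i = 0\<^sub>v n" using c by (simp add: mat_kernel_def)
      from arg_cong[OF this, of "\<lambda>w. w $ i"] show "p i = 0" using i c by (simp add: p_def)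
    qed
    have "(\<Sum>i<n. (p i - q i) / ln 2) \<le> (\<Sum>i<n. p i * log 2 (p i) - p i * log 2 (q i))"
      using p0 q0 qp by (intro sum_mono gibbs_term) auto
    moreover have "(\<Sum>i<n. (p i - q i) / ln 2) = 0"
      using p1 q1 by (simp add: sum_subtractf flip: sum_divide_distrib)
    ultimately have "(\<Sum>i<n. p i * log 2 (q i)) \<le> (\<Sum>i<n. p i * log 2 (p i))"
      by (simp add: sum_subtractf)
    then show ?thesis
      using True by (simp add: relative_entropy_def logs trd SD vn_entropy_def[of \<rho>])
  qed (simp add: relative_entropy_def)
  show ?thesis
    unfolding rel_ent_coherence_def dim
    by (rule antisym) (use dmem att low in \<open>auto intro: INF_lower2 INF_greatest\<close>)
qed

end

theory Submission
  imports Defs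
begin

text \<open>
  Write \<open>\<rho>\<close> for the initial state and \<open>\<tau>\<close> for its image under \<open>\<Phi> \<otimes> \<one>\<^sub>k\<close>; both have the same reduced
  state \<open>\<rho>\<^sup>B\<close>.  As \<open>C\<^sub>r(\<tau>) \<ge> C\<^sub>r(\<rho>\<^sup>B)\<close>, the loss is at most
  \<open>C\<^sub>r(\<rho>) - C\<^sub>r(\<rho>\<^sup>B) = H(A|B) - S(A|B)\<close>, where \<open>H(A|B) \<le> log d\<close> is the classical conditional entropy
  of the dephased state.  If \<open>\<rho> \<le> c (\<one> \<otimes> \<rho>\<^sup>B)\<close> then \<open>S(A|B) \<ge> - log c\<close>; one can take \<open>c = d\<close> for every
  state and \<open>c = 1\<close> for separable ones.

  For \<open>C\<^sub>r(\<tau>) \<ge> C\<^sub>r(\<tau>\<^sup>B)\<close>, put \<open>\<sigma> = \<Delta>[\<tau>]\<close> with diagonal \<open>p\<close> and let \<open>\<tau>\<close> have eigenpairs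
  \<open>(l\<^sub>i, u\<^sub>i)\<close>.  The function \<open>F\<^sub>t = \<Sum>\<^sub>x\<^sub>i |u\<^sub>i(x)|\<^sup>2 l\<^sub>i\<^sup>2 / (p\<^sub>x + t l\<^sub>i)\<close> equals
  \<open>sup\<^sub>X (2 Re Tr[\<tau>X] - Tr[X\<^sup>*\<sigma>X] - t Tr[X\<tau>X\<^sup>*])\<close>; restricting the supremum to \<open>X = \<one> \<otimes> Y\<close> gives
  the same expression for \<open>\<tau>\<^sup>B\<close>, so \<open>F\<^sub>t\<close> decreases under the partial trace.  Integrating over \<open>t \<ge> 0\<close>
  yields the inequality of relative entropies, since \<open>F\<^sub>t\<close> is the derivative of
  \<open>\<Sum>\<^sub>x\<^sub>i |u\<^sub>i(x)|\<^sup>2 l\<^sub>i ln (p\<^sub>x + t l\<^sub>i)\<close>.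
\<close>

section \<open>Eigensystems of positive semidefinite matrices\<close>

lemma mat_trace_mult_commute:
  assumes "A \<in> carrier_mat n n" "B \<in> carrier_mat n n"
  shows "mat_trace (A * B) = mat_trace (B * A)"
  using assms unfolding mat_trace_def
  by (simp add: scalar_prod_def atLeast0LessThan) (subst sum.swap, simp add: mult.commute)

text \<open>The diagonal of a Schur form carries the eigenvalues, so a nonzero entry there yields an
  eigenvector. This supplies the new vector in the induction of
  \<open>psd_orthonormal_eigenvectors\<close>.\<close>

lemma hermitian_nonzero_eigenvalue:
  fixes B :: "complex mat"
  assumes B: "B \<in> carrier_mat n n"
    and herm: "\<And>x y. x < n \<Longrightarrow> y < n \<Longrightarrow> B $$ (x, y) = cnj (B $$ (y, x))"
    and nz: "x0 < n" "y0 < n" "B $$ (x0, y0) \<noteq> 0"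
  obtains e w where "e \<noteq> 0" "w \<in> carrier_vec n" "w \<noteq> 0\<^sub>v n" "B *\<^sub>v w = e \<cdot>\<^sub>v w"
proof -
  obtain es where es: "char_poly B = (\<Prod>e\<leftarrow>es. [:- e, 1:])"
    using char_poly_factorized[OF B] by blast
  obtain T P Q where TPQ: "schur_decomposition B es = (T, P, Q)" by (cases "schur_decomposition B es") auto
  have sim: "similar_mat_wit B T P Q" and ut: "upper_triangular T" and dT: "diag_mat T = es"
    using schur_decomposition[OF B es TPQ] by auto
  have T: "T \<in> carrier_mat n n" "P \<in> carrier_mat n n" "Q \<in> carrier_mat n n"
    and PQ: "Q * P = 1\<^sub>m n" and BT: "B = P * T * Q"
    using sim B by (auto simp: similar_mat_wit_def Let_def)
  \<comment> \<open>Otherwise \<open>Tr[B\<^sup>2] = 0\<close>, but this trace is the sum of the \<open>|B\<^sub>x\<^sub>y|\<^sup>2\<close>.\<close>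
  have "\<exists>e\<in>set es. e \<noteq> 0"
  proof (rule ccontr)
    assume "\<not> ?thesis"
    then have d0: "T $$ (i, i) = 0" if "i < n" for i
      using that T dT by (auto simp: diag_mat_def)
    note as = assoc_mult_mat[of _ n n _ n _ n] mult_carrier_mat[of _ n n _ n]
    have "B * B = P * (T * T * Q)"
    proof -
      have "B * B = P * (T * ((Q * P) * (T * Q)))" using T by (simp add: BT as)
      then show ?thesis using T by (simp add: PQ as)
    qed
    then have "mat_trace (B * B) = mat_trace (T * T * Q * P)"
      using T mat_trace_mult_commute[of P n "T * T * Q"] by (simp add: as)
    also have "T * T * Q * P = T * T" using T PQ by (simp add: as)
    also have "mat_trace (T * T) = 0"
    proof -
      \<comment> \<open>Off the diagonal one of the two factors lies strictly below it; on the
        diagonal both are zero.\<close>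
      have "T $$ (i, j) * T $$ (j, i) = 0" if "i < n" "j < n" for i j
        using that d0 ut T by (cases i j rule: linorder_cases) (auto simp: upper_triangular_def)
      then show ?thesis using T by (auto simp: mat_trace_def scalar_prod_def intro!: sum.neutral)
    qed
    finally have "mat_trace (B * B) = 0" .
    moreover have "mat_trace (B * B) = (\<Sum>x<n. \<Sum>y<n. complex_of_real ((cmod (B $$ (x, y)))\<^sup>2))"
    proof -
      have "mat_trace (B * B) = (\<Sum>x<n. \<Sum>y<n. B $$ (x, y) * B $$ (y, x))"
        using B by (simp add: mat_trace_def scalar_prod_def atLeast0LessThan)
      also have "\<dots> = (\<Sum>x<n. \<Sum>y<n. B $$ (x, y) * cnj (B $$ (x, y)))"
        by (intro sum.cong refl arg_cong2[where f = times] herm) auto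
      finally show ?thesis by (simp only: complex_norm_square)
    qed
    ultimately have "(\<Sum>x<n. \<Sum>y<n. (cmod (B $$ (x, y)))\<^sup>2) = 0"
      by (metis (no_types, lifting) of_real_eq_0_iff of_real_sum sum.cong)
    then show False using nz by (auto simp: sum_nonneg_eq_0_iff sum_nonneg)
  qed
  then obtain e where e: "e \<in> set es" "e \<noteq> 0" by blast
  have "poly (char_poly B) e = 0" using e(1) unfolding es by (simp add: poly_prod_list prod_list_zero_iff image_iff)
  then have "eigenvalue B e" using eigenvalue_root_char_poly[OF B] by simp
  then obtain w where "eigenvector B w e" by (auto simp: eigenvalue_def)
  then show ?thesis using that e(2) B by (auto simp: eigenvector_def)
qed

text \<open>Vectors are coordinate functions of which only the values below \<open>n\<close> are
  read, so splitting an index as \<open>a * k + b\<close> stays plain summation. The first argument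
  is conjugated, opposite to \<open>\<bullet>c\<close>.\<close>

definition ip :: "nat \<Rightarrow> (nat \<Rightarrow> complex) \<Rightarrow> (nat \<Rightarrow> complex) \<Rightarrow> complex" where
  "ip n f g = (\<Sum>x<n. cnj (f x) * g x)"

definition mat_app :: "nat \<Rightarrow> complex mat \<Rightarrow> (nat \<Rightarrow> complex) \<Rightarrow> nat \<Rightarrow> complex" where
  "mat_app n A f x = (\<Sum>y<n. A $$ (x, y) * f y)"

section \<open>Sesquilinear calculus for coordinate functions\<close>

lemma ip_cong: "(\<And>x. x < n \<Longrightarrow> f x = f' x) \<Longrightarrow> (\<And>x. x < n \<Longrightarrow> g x = g' x) \<Longrightarrow> ip n f g = ip n f' g'"
  by (simp add: ip_def)

lemma cnj_ip: "cnj (ip n f g) = ip n g f"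
  by (simp add: ip_def mult.commute)

lemma ip_self: "ip n f f = complex_of_real (\<Sum>x<n. (cmod (f x))\<^sup>2)"
  unfolding ip_def of_real_sum complex_norm_square by (simp add: mult.commute)

lemma ip_add_right: "ip n f (\<lambda>x. g x + h x) = ip n f g + ip n f h"
  by (simp add: ip_def algebra_simps sum.distrib)

lemma ip_scale_right: "ip n f (\<lambda>x. c * g x) = c * ip n f g"
  by (simp add: ip_def sum_distrib_left mult.left_commute)

lemma ip_scale_left: "ip n (\<lambda>x. c * f x) g = cnj c * ip n f g"
  by (simp add: ip_def sum_distrib_left mult.assoc)

lemma ip_sum_right: "ip n f (\<lambda>x. \<Sum>i\<in>I. c i * g i x) = (\<Sum>i\<in>I. c i * ip n f (g i))"
  unfolding ip_def sum_distrib_left by (subst sum.swap) (simp add: mult.left_commute)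

lemma ip_mat_app: "ip n f (mat_app n A g) = (\<Sum>x<n. \<Sum>y<n. A $$ (x, y) * g y * cnj (f x))"
  by (simp add: ip_def mat_app_def sum_distrib_left mult.commute mult.left_commute)

lemma psd_ip_mat_app:
  assumes "psd n A"
  shows "0 \<le> ip n f (mat_app n A f)"
proof -
  define g where "g i = (if i < n then f i else 0)" for i
  have "0 \<le> (\<Sum>x<n. \<Sum>y<n. A $$ (x, y) * g y * cnj (g x))"
    using assms by (intro psd_quad_form[of n A "{..<n}" g]) (auto simp: g_def)
  also have "\<dots> = ip n f (mat_app n A f)"
    unfolding ip_mat_app by (intro sum.cong) (auto simp: g_def)
  finally show ?thesis .
qed

lemma psdI:
  assumes A: "A \<in> carrier_mat n n" and "\<And>f. 0 \<le> ip n f (mat_app n A f)"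
  shows "psd n A"
  unfolding psd_def
proof (intro conjI ballI)
  fix v :: "complex vec" assume v: "v \<in> carrier_vec n"
  have "(A *\<^sub>v v) \<bullet>c v = ip n (\<lambda>i. v $ i) (mat_app n A (\<lambda>i. v $ i))"
    using A v unfolding ip_mat_app
    by (simp add: scalar_prod_def mult_mat_vec_def sum_distrib_right atLeast0LessThan)
  then show "0 \<le> (A *\<^sub>v v) \<bullet>c v" using assms(2) by simp
qed (rule A)

text \<open>\<open>psd\<close> asks only for a nonnegative quadratic form. Its reality on the
  vectors \<open>t e_x + e_y\<close> pins the off-diagonal entries: \<open>t = 1\<close> relates
  their imaginary parts, \<open>t = \<i>\<close> their real parts.\<close>

lemma psd_hermitian:
  assumes A: "psd n A" and xy: "x < n" "y < n"
  shows "A $$ (x, y) = cnj (A $$ (y, x))"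
proof (cases "x = y")
  case True
  then show ?thesis
    using psd_diag_nonneg[OF A xy(1)] by (simp add: less_eq_complex_def complex_eq_iff)
next
  case False
  define a b c p where "a = A $$ (x, x)" and "b = A $$ (x, y)" and "c = A $$ (y, x)" and "p = A $$ (y, y)"
  have *: "0 \<le> a * (t * cnj t) + b * cnj t + c * t + p" for t
  proof -
    have "0 \<le> (\<Sum>i\<in>{x, y}. \<Sum>j\<in>{x, y}. A $$ (i, j) * (if j = x then t else if j = y then 1 else 0)
        * cnj (if i = x then t else if i = y then 1 else 0))"
      using xy by (intro psd_quad_form[OF A]) auto
    then show ?thesis using False by (simp add: a_def b_def c_def p_def algebra_simps)
  qed
  have im: "Im a = 0" "Im p = 0"
    using psd_diag_nonneg[OF A] xy by (auto simp: a_def p_def less_eq_complex_def)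
  have "Im b + Im c = 0" using *[of 1] im by (simp add: less_eq_complex_def)
  moreover have "Re b = Re c" using *[of \<i>] im by (simp add: less_eq_complex_def)
  ultimately have "b = cnj c" by (simp add: complex_eq_iff)
  then show ?thesis by (simp add: b_def c_def)
qed

lemma ip_mat_app_adjoint:
  assumes "\<And>x y. x < n \<Longrightarrow> y < n \<Longrightarrow> A $$ (x, y) = cnj (A $$ (y, x))"
  shows "ip n f (mat_app n A g) = ip n (mat_app n A f) g"
proof -
  have "ip n f (mat_app n A g) = (\<Sum>y<n. \<Sum>x<n. A $$ (x, y) * g y * cnj (f x))"
    unfolding ip_mat_app by (rule sum.swap)
  also have "\<dots> = (\<Sum>y<n. \<Sum>x<n. cnj (A $$ (y, x)) * g y * cnj (f x))"
    by (intro sum.cong refl arg_cong2[where f = times] assms) auto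
  also have "\<dots> = ip n (mat_app n A f) g"
    by (simp add: ip_def mat_app_def sum_distrib_right sum_distrib_left mult.commute mult.left_commute)
  finally show ?thesis .
qed

lemma psd_orthonormal_eigenvectors:
  assumes A: "psd n A" and "k \<le> n"
  shows "\<exists>u l. (\<forall>i<k. \<forall>j<k. ip n (u i) (u j) = of_bool (i = j)) \<and>
    (\<forall>i<k. 0 \<le> l i \<and> (\<forall>x<n. mat_app n A (u i) x = complex_of_real (l i) * u i x))"
  using \<open>k \<le> n\<close>
proof (induction k)
  case (Suc k)
  then have "\<exists>u l. (\<forall>i<k. \<forall>j<k. ip n (u i) (u j) = of_bool (i = j)) \<and>
    (\<forall>i<k. 0 \<le> l i \<and> (\<forall>x<n. mat_app n A (u i) x = complex_of_real (l i) * u i x))"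
    by simp
  then obtain u l where on: "\<forall>i<k. \<forall>j<k. ip n (u i) (u j) = of_bool (i = j)"
    and "\<forall>i<k. 0 \<le> l i \<and> (\<forall>x<n. mat_app n A (u i) x = complex_of_real (l i) * u i x)"
    by (elim exE conjE)
  then have l: "0 \<le> l i" and eig: "x < n \<Longrightarrow> mat_app n A (u i) x = complex_of_real (l i) * u i x"
    if "i < k" for i x
    using that by auto
  have kn: "k < n" using Suc.prems by simp
  \<comment> \<open>\<open>z y\<close> is the projection of the basis vector \<open>e_y\<close> onto
    the complement of the vectors found so far. That projection has trace \<open>n - k\<close>, so
    some diagonal entry \<open>z y y\<close> is nonzero.\<close>
  define z where "z y x = of_bool (x = y) - (\<Sum>i<k. cnj (u i y) * u i x)" for x y
  have "(\<Sum>y<n. z y y) = of_nat n - (\<Sum>i<k. ip n (u i) (u i))"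
    unfolding z_def ip_def sum_subtractf by (subst sum.swap) simp
  also have "\<dots> = of_nat n - of_nat k" using on by simp
  also have "\<dots> \<noteq> 0" using kn by simp
  finally obtain y where y: "y < n" "z y y \<noteq> 0" by (auto elim: sum.not_neutral_contains_not_neutral)
  have z_orth: "ip n (u j) (z y) = 0" if "j < k" for j
  proof -
    have "ip n (u j) (z y) = ip n (u j) (\<lambda>x. of_bool (x = y)) - ip n (u j) (\<lambda>x. \<Sum>i<k. cnj (u i y) * u i x)"
      by (simp add: z_def ip_def algebra_simps sum_subtractf)
    also have "ip n (u j) (\<lambda>x. of_bool (x = y)) = cnj (u j y)"
      using y by (simp add: ip_def of_bool_def if_distrib sum.delta cong: if_cong)
    also have "ip n (u j) (\<lambda>x. \<Sum>i<k. cnj (u i y) * u i x) = (\<Sum>i<k. cnj (u i y) * of_bool (j = i))"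
      unfolding ip_sum_right using on that by (intro sum.cong) auto
    also have "\<dots> = cnj (u j y)"
      using that by (simp add: of_bool_def if_distrib sum.delta cong: if_cong)
    finally show ?thesis by simp
  qed
  \<comment> \<open>Deflation: \<open>A + 1\<close> is invertible and \<open>B\<close> is its restriction to the complement of \<open>u\<^sub>0, \<dots>, u\<^sub>k\<^sub>-\<^sub>1\<close>,
    hence every eigenvector of \<open>B\<close> for a nonzero eigenvalue is a new eigenvector of \<open>A\<close>.\<close>
  define B where "B = mat n n (\<lambda>(x, x'). A $$ (x, x') + of_bool (x = x')
    - (\<Sum>i<k. complex_of_real (l i + 1) * (u i x * cnj (u i x'))))"
  have mat_app_B: "mat_app n B f x = mat_app n A f x + f x - (\<Sum>i<k. complex_of_real (l i + 1) * ip n (u i) f * u i x)"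
    if "x < n" for f x
  proof -
    have "mat_app n B f x = mat_app n A f x + (\<Sum>x'<n. of_bool (x = x') * f x')
        - (\<Sum>x'<n. \<Sum>i<k. complex_of_real (l i + 1) * (u i x * cnj (u i x')) * f x')"
      using that by (simp add: mat_app_def B_def algebra_simps sum.distrib sum_subtractf sum_distrib_left)
    also have "(\<Sum>x'<n. of_bool (x = x') * f x') = f x"
      using that by (simp add: of_bool_def if_distrib if_distribR sum.delta cong: if_cong)
    also have "(\<Sum>x'<n. \<Sum>i<k. complex_of_real (l i + 1) * (u i x * cnj (u i x')) * f x')
      = (\<Sum>i<k. complex_of_real (l i + 1) * ip n (u i) f * u i x)"
      unfolding ip_def by (subst sum.swap) (simp add: sum_distrib_left sum_distrib_right mult_ac)
    finally show ?thesis .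
  qed
  have herm: "B $$ (x, x') = cnj (B $$ (x', x))" if "x < n" "x' < n" for x x'
    using that psd_hermitian[OF A that, symmetric] by (cases "x = x'") (simp_all add: B_def mult.commute)
  \<comment> \<open>If \<open>B\<close> vanished, \<open>A\<close> would act as -1 on the nonzero
    vector \<open>z y\<close>, against positivity.\<close>
  have "\<exists>x0 y0. x0 < n \<and> y0 < n \<and> B $$ (x0, y0) \<noteq> 0"
  proof (rule ccontr)
    assume "\<not> ?thesis"
    then have "mat_app n B (z y) x = 0" if "x < n" for x using that by (simp add: mat_app_def)
    then have "mat_app n A (z y) x + z y x = 0" if "x < n" for x
      using mat_app_B[OF that, of "z y"] that z_orth by simp
    then have "ip n (z y) (\<lambda>x. mat_app n A (z y) x + z y x) = 0" by (simp add: ip_def)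
    then have "ip n (z y) (mat_app n A (z y)) + ip n (z y) (z y) = 0" by (simp add: ip_add_right)
    moreover have "0 \<le> ip n (z y) (mat_app n A (z y))" by (rule psd_ip_mat_app[OF A])
    ultimately have "(\<Sum>x<n. (cmod (z y x))\<^sup>2) \<le> 0"
      by (simp add: ip_self less_eq_complex_def complex_eq_iff)
    moreover have "(cmod (z y y))\<^sup>2 \<le> (\<Sum>x<n. (cmod (z y x))\<^sup>2)"
      using y by (intro member_le_sum) auto
    moreover have "0 < (cmod (z y y))\<^sup>2" using y by simp
    ultimately show False by linarith
  qed
  then obtain x0 y0 where xy: "x0 < n" "y0 < n" "B $$ (x0, y0) \<noteq> 0" by blast
  have Bc: "B \<in> carrier_mat n n" by (simp add: B_def)
  obtain e v where e: "e \<noteq> 0" and v: "v \<in> carrier_vec n" "v \<noteq> 0\<^sub>v n" "B *\<^sub>v v = e \<cdot>\<^sub>v v"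
    by (rule hermitian_nonzero_eigenvalue[OF Bc herm xy])
  define w where "w x = v $ x" for x
  have Bw: "mat_app n B w x = e * w x" if "x < n" for x
    using arg_cong[OF v(3), of "\<lambda>v. v $ x"] that v(1)
    by (simp add: mat_app_def w_def B_def scalar_prod_def atLeast0LessThan)
  \<comment> \<open>\<open>B\<close> is Hermitian and kills every \<open>u j\<close>, so an
    eigenvector with \<open>e \<noteq> 0\<close> is orthogonal to them.\<close>
  have w_orth: "ip n (u j) w = 0" if j: "j < k" for j
  proof -
    have "mat_app n B (u j) x = 0" if "x < n" for x
    proof -
      have "(\<Sum>i<k. complex_of_real (l i + 1) * ip n (u i) (u j) * u i x)
          = (\<Sum>i<k. if i = j then complex_of_real (l j + 1) * u j x else 0)"
        using on j by (intro sum.cong) auto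
      then show ?thesis using j by (simp add: mat_app_B[OF that] eig[OF j that] algebra_simps)
    qed
    then have "ip n (mat_app n B (u j)) w = 0" by (simp add: ip_def)
    then have "ip n (u j) (mat_app n B w) = 0" using ip_mat_app_adjoint[OF herm, where f = "u j" and g = w] by simp
    moreover have "ip n (u j) (mat_app n B w) = e * ip n (u j) w"
      using Bw by (simp add: ip_scale_right[symmetric] cong: ip_cong)
    ultimately show ?thesis using e by simp
  qed
  \<comment> \<open>On the complement \<open>B\<close> acts as \<open>A + 1\<close>, hence the shift
    of the eigenvalue by one.\<close>
  have Aw: "mat_app n A w x = (e - 1) * w x" if "x < n" for x
    using mat_app_B[OF that, of w] Bw[OF that] w_orth by (simp add: algebra_simps)
  define c where "c = (\<Sum>x<n. (cmod (w x))\<^sup>2)"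
  have c: "0 < c"
  proof -
    obtain x where x: "x < n" "w x \<noteq> 0" using v(1,2) by (auto simp: w_def vec_eq_iff)
    have "(cmod (w x))\<^sup>2 \<le> c" unfolding c_def using x by (intro member_le_sum) auto
    moreover have "0 < (cmod (w x))\<^sup>2" using x by simp
    ultimately show ?thesis by linarith
  qed
  have "0 \<le> ip n w (mat_app n A w)" by (rule psd_ip_mat_app[OF A])
  also have "ip n w (mat_app n A w) = (e - 1) * complex_of_real c"
    using Aw by (simp add: ip_scale_right ip_self c_def cong: ip_cong)
  finally have e1: "0 \<le> Re (e - 1)" "complex_of_real (Re (e - 1)) = e - 1"
    using c by (auto simp: less_eq_complex_def complex_eq_iff zero_le_mult_iff)
  define r where "r = 1 / sqrt c"
  have r: "r * r * c = 1" using c by (simp add: r_def)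
  define w' where "w' x = complex_of_real r * w x" for x
  have w'_orth: "ip n (u j) w' = 0" if "j < k" for j
    unfolding w'_def ip_scale_right using w_orth[OF that] by simp
  then have w'_orth': "ip n w' (u j) = 0" if "j < k" for j
    using cnj_ip[of n "u j" w'] that by simp
  have "ip n w' w' = complex_of_real (r * r * c)"
    unfolding w'_def ip_scale_right ip_scale_left unfolding ip_self c_def[symmetric] by simp
  then have w'_unit: "ip n w' w' = 1" using r by simp
  have w'_eig: "mat_app n A w' x = (e - 1) * w' x" if "x < n" for x
    using Aw[OF that]
    by (simp add: mat_app_def w'_def mult.left_commute flip: sum_distrib_left)
  show ?case
  proof (intro exI[of _ "u(k := w')"] exI[of _ "l(k := Re (e - 1))"] conjI allI impI)
    fix i j assume "i < Suc k" "j < Suc k"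
    then show "ip n ((u(k := w')) i) ((u(k := w')) j) = of_bool (i = j)"
      using on w'_orth w'_orth' w'_unit by (auto simp: less_Suc_eq)
  qed (use l e1 eig w'_eig in \<open>auto simp: less_Suc_eq\<close>)
qed auto

text \<open>Completeness is stored beside orthonormality: Parseval uses the former, expansion
  coefficients the latter.\<close>

definition eigensystem :: "nat \<Rightarrow> complex mat \<Rightarrow> (nat \<Rightarrow> real) \<Rightarrow> (nat \<Rightarrow> nat \<Rightarrow> complex) \<Rightarrow> bool" where
  "eigensystem n A l u \<longleftrightarrow>
     (\<forall>i<n. 0 \<le> l i) \<and>
     (\<forall>i<n. \<forall>j<n. ip n (u i) (u j) = of_bool (i = j)) \<and>
     (\<forall>x<n. \<forall>y<n. (\<Sum>i<n. u i x * cnj (u i y)) = of_bool (x = y)) \<and>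
     (\<forall>x<n. \<forall>y<n. A $$ (x, y) = (\<Sum>i<n. complex_of_real (l i) * (u i x * cnj (u i y))))"

lemma psd_eigensystem:
  assumes A: "psd n A"
  obtains l u where "eigensystem n A l u"
proof -
  obtain u l where on: "\<forall>i<n. \<forall>j<n. ip n (u i) (u j) = of_bool (i = j)"
    and "\<forall>i<n. 0 \<le> l i \<and> (\<forall>x<n. mat_app n A (u i) x = complex_of_real (l i) * u i x)"
    using psd_orthonormal_eigenvectors[OF A order_refl] by (elim exE conjE)
  then have l: "0 \<le> l i" and eig: "x < n \<Longrightarrow> mat_app n A (u i) x = complex_of_real (l i) * u i x"
    if "i < n" for i x
    using that by auto
  define U where "U = mat n n (\<lambda>(x, i). u i x)"
  define V where "V = mat n n (\<lambda>(i, x). cnj (u i x))"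
  have "V * U = 1\<^sub>m n"
    using on by (intro eq_matI) (auto simp: U_def V_def scalar_prod_def ip_def atLeast0LessThan)
  \<comment> \<open>Orthonormality says that a square matrix has a left inverse; read as a right
    inverse, this is completeness.\<close>
  then have "U * V = 1\<^sub>m n"
    by (rule mat_mult_left_right_inverse[rotated 2]) (auto simp: U_def V_def)
  have compl: "(\<Sum>i<n. u i x * cnj (u i y)) = of_bool (x = y)" if "x < n" "y < n" for x y
    using arg_cong[OF \<open>U * V = 1\<^sub>m n\<close>, of "\<lambda>M. M $$ (x, y)"] that
    by (simp add: U_def V_def scalar_prod_def atLeast0LessThan)
  have "A $$ (x, y) = (\<Sum>i<n. complex_of_real (l i) * (u i x * cnj (u i y)))"
    if "x < n" "y < n" for x y
  proof -
    have "(\<Sum>i<n. complex_of_real (l i) * (u i x * cnj (u i y))) = (\<Sum>i<n. mat_app n A (u i) x * cnj (u i y))"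
      using eig that by (intro sum.cong) auto
    also have "\<dots> = (\<Sum>z<n. A $$ (x, z) * (\<Sum>i<n. u i z * cnj (u i y)))"
      unfolding mat_app_def sum_distrib_right sum_distrib_left by (subst sum.swap) (simp add: mult.assoc)
    also have "\<dots> = (\<Sum>z<n. if z = y then A $$ (x, y) else 0)"
      using compl that by (intro sum.cong) auto
    finally show ?thesis using that by simp
  qed
  then have "eigensystem n A l u" using on l compl unfolding eigensystem_def by blast
  then show ?thesis by (rule that)
qed

section \<open>Partial trace\<close>

text \<open>The vector \<open>(<a| tensor 1) f\<close> of the second system.\<close>

definition block :: "nat \<Rightarrow> nat \<Rightarrow> (nat \<Rightarrow> complex) \<Rightarrow> nat \<Rightarrow> complex" where
  "block k a f b = f (a * k + b)"

definition ptrace :: "nat \<Rightarrow> nat \<Rightarrow> complex mat \<Rightarrow> complex mat" where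
  "ptrace d k A = mat k k (\<lambda>(r, s). \<Sum>a<d. A $$ (a * k + r, a * k + s))"

lemma sum_over_blocks: "(\<Sum>x<d * k. f x) = (\<Sum>a<d. \<Sum>b<k. f (a * k + b))" for k :: nat
proof -
  have "(\<Sum>b = a * k..<a * k + k. f b) = (\<Sum>b<k. f (a * k + b))" for a
    using sum.shift_bounds_nat_ivl[of f 0 "a * k" k] by (simp add: atLeast0LessThan add.commute)
  then show ?thesis by (simp add: sum.nat_group[symmetric])
qed

lemma block_index_less: "a < d \<Longrightarrow> b < k \<Longrightarrow> a * k + b < d * k" for k :: nat
proof -
  assume "a < d" "b < k"
  then have "a * k + b < (a + 1) * k" by simp
  also have "\<dots> \<le> d * k" using \<open>a < d\<close> by (intro mult_le_mono1) simp
  finally show ?thesis .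
qed

lemma ip_block: "ip (d * k) f g = (\<Sum>a<d. ip k (block k a f) (block k a g))"
  by (simp add: ip_def sum_over_blocks block_def)

text \<open>Each product is the form of a rank-one matrix. The weights \<open>l\<close> give the
  form of \<open>A\<close>, the weights 1 give Parseval, and blocks in place of \<open>u\<close>
  give the form of the reduced matrix.\<close>

lemma sum_ip_products:
  "(\<Sum>i\<in>I. c i * (ip n f (u i) * ip n (u i) g))
    = (\<Sum>x<n. \<Sum>y<n. (\<Sum>i\<in>I. c i * (u i x * cnj (u i y))) * g y * cnj (f x))"
proof -
  have "(\<Sum>i\<in>I. c i * (ip n f (u i) * ip n (u i) g))
      = (\<Sum>i\<in>I. \<Sum>x<n. \<Sum>y<n. c i * (u i x * cnj (u i y)) * g y * cnj (f x))"
    unfolding ip_def sum_product unfolding sum_distrib_left by (intro sum.cong refl) (simp add: mult_ac)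
  also have "\<dots> = (\<Sum>x<n. \<Sum>i\<in>I. \<Sum>y<n. c i * (u i x * cnj (u i y)) * g y * cnj (f x))"
    by (rule sum.swap)
  also have "\<dots> = (\<Sum>x<n. \<Sum>y<n. \<Sum>i\<in>I. c i * (u i x * cnj (u i y)) * g y * cnj (f x))"
    by (intro sum.cong refl sum.swap)
  finally show ?thesis by (simp add: sum_distrib_right)
qed

section \<open>Forms, diagonals and traces expressed through an eigensystem\<close>

lemma eigensystem_form:
  assumes "eigensystem n A l u"
  shows "ip n f (mat_app n A g) = (\<Sum>i<n. complex_of_real (l i) * (ip n f (u i) * ip n (u i) g))"
  unfolding sum_ip_products ip_mat_app
  by (intro sum.cong refl arg_cong2[where f = times]) (use assms in \<open>auto simp: eigensystem_def\<close>)

lemma eigensystem_parseval: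
  assumes "eigensystem n A l u"
  shows "(\<Sum>i<n. ip n f (u i) * ip n (u i) g) = ip n f g"
proof -
  have "(\<Sum>i<n. ip n f (u i) * ip n (u i) g)
      = (\<Sum>x<n. \<Sum>y<n. (\<Sum>i<n. u i x * cnj (u i y)) * g y * cnj (f x))"
    using sum_ip_products[of "\<lambda>_. 1" n f u g "{..<n}"] by simp
  also have "\<dots> = (\<Sum>x<n. \<Sum>y<n. if y = x then g x * cnj (f x) else 0)"
    using assms by (intro sum.cong refl) (auto simp: eigensystem_def)
  also have "\<dots> = ip n f g" by (simp add: ip_def mult.commute)
  finally show ?thesis .
qed

lemma ip_mult_ip_swap: "ip n f g * ip n g f = complex_of_real ((cmod (ip n g f))\<^sup>2)"
  unfolding complex_norm_square by (simp add: cnj_ip mult.commute)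

lemma cmod_ip_commute: "cmod (ip n f g) = cmod (ip n g f)"
  using cnj_ip[of n f g] complex_mod_cnj by metis

lemma eigensystem_quadratic_form:
  assumes "eigensystem n A l u"
  shows "Re (ip n f (mat_app n A f)) = (\<Sum>i<n. l i * (cmod (ip n (u i) f))\<^sup>2)"
  unfolding eigensystem_form[OF assms] ip_mult_ip_swap Re_sum
  by (simp add: Re_divide_of_real flip: of_real_mult of_real_power)

lemma eigensystem_parseval_norm:
  assumes "eigensystem n A l u"
  shows "(\<Sum>i<n. (cmod (ip n (u i) f))\<^sup>2) = (\<Sum>x<n. (cmod (f x))\<^sup>2)"
proof -
  have "complex_of_real (\<Sum>i<n. (cmod (ip n (u i) f))\<^sup>2) = complex_of_real (\<Sum>x<n. (cmod (f x))\<^sup>2)"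
    using eigensystem_parseval[OF assms, of f f] unfolding ip_mult_ip_swap ip_self of_real_sum .
  then show ?thesis by (simp only: of_real_eq_iff)
qed

lemma ip_orthonormal_expansion:
  assumes "\<And>i j. i < n \<Longrightarrow> j < n \<Longrightarrow> ip n (u i) (u j) = of_bool (i = j)" and "j < n"
  shows "ip n (u j) (\<lambda>x. \<Sum>i<n. c i * u i x) = c j"
proof -
  have "ip n (u j) (\<lambda>x. \<Sum>i<n. c i * u i x) = (\<Sum>i<n. if i = j then c j else 0)"
    unfolding ip_sum_right using assms by (intro sum.cong) auto
  then show ?thesis using assms by simp
qed

lemma eigensystem_orthonormal:
  "eigensystem n A l u \<Longrightarrow> i < n \<Longrightarrow> j < n \<Longrightarrow> ip n (u i) (u j) = of_bool (i = j)"
  by (simp add: eigensystem_def)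

lemma eigensystem_nonneg: "eigensystem n A l u \<Longrightarrow> i < n \<Longrightarrow> 0 \<le> l i"
  by (simp add: eigensystem_def)

lemma eigensystem_unit:
  assumes "eigensystem n A l u" "i < n"
  shows "(\<Sum>x<n. (cmod (u i x))\<^sup>2) = 1"
proof -
  have "complex_of_real (\<Sum>x<n. (cmod (u i x))\<^sup>2) = 1"
    using eigensystem_orthonormal[OF assms assms(2)] unfolding ip_self by simp
  then show ?thesis by (simp only: of_real_eq_1_iff)
qed

lemma eigensystem_diag:
  assumes "eigensystem n A l u" "x < n"
  shows "Re (A $$ (x, x)) = (\<Sum>i<n. l i * (cmod (u i x))\<^sup>2)"
proof -
  have "A $$ (x, x) = complex_of_real (\<Sum>i<n. l i * (cmod (u i x))\<^sup>2)"
    unfolding of_real_sum of_real_mult complex_norm_square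
    using assms by (simp add: eigensystem_def)
  then show ?thesis by simp
qed

lemma eigensystem_trace:
  assumes "eigensystem n A l u" "A \<in> carrier_mat n n"
  shows "Re (mat_trace A) = (\<Sum>i<n. l i)"
proof -
  have "Re (mat_trace A) = (\<Sum>x<n. \<Sum>i<n. l i * (cmod (u i x))\<^sup>2)"
    using assms by (simp add: mat_trace_def eigensystem_diag[OF assms(1)])
  also have "\<dots> = (\<Sum>i<n. l i * (\<Sum>x<n. (cmod (u i x))\<^sup>2))"
    unfolding sum_distrib_left by (rule sum.swap)
  also have "\<dots> = (\<Sum>i<n. l i)" using eigensystem_unit[OF assms(1)] by simp
  finally show ?thesis .
qed

text \<open>Tracing out the first system turns each \<open>|u_i><u_i|\<close> into the sum over
  \<open>a\<close> of the rank-one operators on its blocks. The blocks need not be orthogonal, but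
  positivity is visible.\<close>

lemma ptrace_form:
  assumes es: "eigensystem (d * k) A l u"
  shows "ip k f (mat_app k (ptrace d k A) g)
    = (\<Sum>a<d. \<Sum>i<d * k. complex_of_real (l i) * (ip k f (block k a (u i)) * ip k (block k a (u i)) g))"
proof -
  have "ip k f (mat_app k (ptrace d k A) g)
      = (\<Sum>r<k. \<Sum>s<k. \<Sum>a<d. A $$ (a * k + r, a * k + s) * g s * cnj (f r))"
    unfolding ip_mat_app ptrace_def by (simp add: sum_distrib_right)
  also have "\<dots> = (\<Sum>r<k. \<Sum>a<d. \<Sum>s<k. A $$ (a * k + r, a * k + s) * g s * cnj (f r))"
    by (intro sum.cong refl sum.swap)
  also have "\<dots> = (\<Sum>a<d. \<Sum>r<k. \<Sum>s<k. A $$ (a * k + r, a * k + s) * g s * cnj (f r))"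
    by (rule sum.swap)
  also have "\<dots> = (\<Sum>a<d. \<Sum>i<d * k. complex_of_real (l i) * (ip k f (block k a (u i)) * ip k (block k a (u i)) g))"
    unfolding sum_ip_products using es
    by (intro sum.cong refl arg_cong2[where f = times])
      (auto simp: eigensystem_def block_def block_index_less)
  finally show ?thesis .
qed

lemma ptrace_diag:
  assumes "b < k"
  shows "Re (ptrace d k A $$ (b, b)) = (\<Sum>a<d. Re (A $$ (a * k + b, a * k + b)))"
  using assms by (simp add: ptrace_def)

lemma ptrace_psd:
  assumes "psd (d * k) A"
  shows "psd k (ptrace d k A)"
proof (rule psdI)
  fix f
  obtain l u where es: "eigensystem (d * k) A l u" using psd_eigensystem[OF assms] .
  show "0 \<le> ip k f (mat_app k (ptrace d k A) f)"
    unfolding ptrace_form[OF es] ip_mult_ip_swap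
    using eigensystem_nonneg[OF es]
    by (intro sum_nonneg) (auto simp: less_eq_complex_def simp flip: of_real_mult of_real_power)
qed (simp add: ptrace_def)

lemma ptrace_trace:
  assumes "A \<in> carrier_mat (d * k) (d * k)"
  shows "mat_trace (ptrace d k A) = mat_trace A"
  using assms by (simp add: mat_trace_def ptrace_def sum_over_blocks) (rule sum.swap)

section \<open>Coherence decreases under the partial trace\<close>

text \<open>A summand of the primitive of \<open>F_t\<close>. By \<open>supp\<close> the argument of
  \<open>ln\<close> is positive, already at \<open>t = 0\<close>, wherever the weight
  \<open>w * l\<close> is nonzero.\<close>

lemma log_term_has_derivative:
  fixes w l p t :: real
  assumes "0 \<le> w" "0 \<le> l" "0 \<le> p" "0 \<le> t" and supp: "p = 0 \<Longrightarrow> w * l = 0"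
  shows "((\<lambda>t. w * l * ln (p + t * l)) has_real_derivative w * (l\<^sup>2 / (p + t * l))) (at t)"
proof (cases "w * l = 0")
  case False
  then have "p \<noteq> 0" using supp by blast
  then have "0 < p + t * l" using assms by (simp add: add_pos_nonneg)
  then show ?thesis
    by (auto intro!: derivative_eq_intros simp: power2_eq_square)
qed auto

text \<open>For \<open>t > 0\<close> the difference is \<open>w * l * ln (p / t + l)\<close>, and
  \<open>p / t\<close> tends to zero.\<close>

lemma log_term_tendsto:
  fixes w l p :: real
  assumes "0 \<le> w" "0 \<le> l" "0 \<le> p"
  shows "((\<lambda>t. w * l * ln (p + t * l) - w * l * ln t) \<longlongrightarrow> w * l * ln l) at_top"
proof (cases "w * l = 0")
  case False
  then have l: "0 < l" using assms by auto
  have "((\<lambda>t. p / t) \<longlongrightarrow> 0) at_top"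
    by (rule real_tendsto_divide_at_top[OF tendsto_const filterlim_ident])
  from tendsto_add[OF this tendsto_const[of l]]
  have "((\<lambda>t. w * l * ln (p / t + l)) \<longlongrightarrow> w * l * ln l) at_top"
    using l by (intro tendsto_mult tendsto_const tendsto_ln) auto
  moreover have "\<forall>\<^sub>F t in at_top. w * l * ln (p / t + l) = w * l * ln (p + t * l) - w * l * ln t"
  proof (rule eventually_mono[OF eventually_gt_at_top[of 0]])
    fix t :: real assume t: "0 < t"
    then have "0 < p + t * l" using l assms by (simp add: add_nonneg_pos)
    moreover have "p / t + l = (p + t * l) / t" using t by (simp add: field_simps)
    ultimately show "w * l * ln (p / t + l) = w * l * ln (p + t * l) - w * l * ln t"
      using t by (simp add: ln_div algebra_simps)
  qed
  ultimately show ?thesis by (rule Lim_transform_eventually)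
qed auto

text \<open>\<open>G\<close> is nondecreasing because \<open>le\<close> compares derivatives, so its
  value at 0 is at most its limit. At 0 it consists of the terms with \<open>ln p\<close>, at
  infinity of those with \<open>ln l\<close>.\<close>

lemma log_comparison:
  fixes w l p :: "'a \<Rightarrow> real" and w' l' p' :: "'b \<Rightarrow> real"
  assumes nonneg: "\<And>x. x \<in> A \<Longrightarrow> 0 \<le> w x \<and> 0 \<le> l x \<and> 0 \<le> p x"
    and nonneg': "\<And>y. y \<in> B \<Longrightarrow> 0 \<le> w' y \<and> 0 \<le> l' y \<and> 0 \<le> p' y"
    and supp: "\<And>x. x \<in> A \<Longrightarrow> p x = 0 \<Longrightarrow> w x * l x = 0"
    and supp': "\<And>y. y \<in> B \<Longrightarrow> p' y = 0 \<Longrightarrow> w' y * l' y = 0"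
    and total: "(\<Sum>x\<in>A. w x * l x) = (\<Sum>y\<in>B. w' y * l' y)"
    and le: "\<And>t. 0 \<le> t \<Longrightarrow>
      (\<Sum>y\<in>B. w' y * ((l' y)\<^sup>2 / (p' y + t * l' y))) \<le> (\<Sum>x\<in>A. w x * ((l x)\<^sup>2 / (p x + t * l x)))"
  shows "(\<Sum>x\<in>A. w x * l x * ln (p x)) - (\<Sum>y\<in>B. w' y * l' y * ln (p' y))
    \<le> (\<Sum>x\<in>A. w x * l x * ln (l x)) - (\<Sum>y\<in>B. w' y * l' y * ln (l' y))"
proof -
  define G where "G t = (\<Sum>x\<in>A. w x * l x * ln (p x + t * l x))
    - (\<Sum>y\<in>B. w' y * l' y * ln (p' y + t * l' y))" for t
  have "G 0 \<le> G t" if "0 \<le> t" for t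
  proof (rule DERIV_nonneg_imp_nondecreasing[OF that])
    fix s :: real assume s: "0 \<le> s"
    have "(G has_real_derivative
        (\<Sum>x\<in>A. w x * ((l x)\<^sup>2 / (p x + s * l x))) - (\<Sum>y\<in>B. w' y * ((l' y)\<^sup>2 / (p' y + s * l' y)))) (at s)"
      unfolding G_def using nonneg nonneg' supp supp' s
      by (intro DERIV_diff DERIV_sum log_term_has_derivative) auto
    then show "\<exists>y. (G has_real_derivative y) (at s) \<and> 0 \<le> y"
      using le[OF s] by auto
  qed
  then have ev: "\<forall>\<^sub>F t in at_top. G 0 \<le> G t"
    by (auto intro: eventually_mono[OF eventually_ge_at_top[of 0]])
  have "((\<lambda>t. (\<Sum>x\<in>A. w x * l x * ln (p x + t * l x) - w x * l x * ln t)
      - (\<Sum>y\<in>B. w' y * l' y * ln (p' y + t * l' y) - w' y * l' y * ln t)) \<longlongrightarrow>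
      (\<Sum>x\<in>A. w x * l x * ln (l x)) - (\<Sum>y\<in>B. w' y * l' y * ln (l' y))) at_top"
    using nonneg nonneg' by (intro tendsto_diff tendsto_sum log_term_tendsto) auto
  \<comment> \<open>Equal total weights cancel the divergent \<open>ln t\<close> on the two
    sides.\<close>
  moreover have "(\<Sum>x\<in>A. w x * l x * ln (p x + t * l x) - w x * l x * ln t)
      - (\<Sum>y\<in>B. w' y * l' y * ln (p' y + t * l' y) - w' y * l' y * ln t) = G t" for t
    using total by (simp add: G_def sum_subtractf flip: sum_distrib_right)
  ultimately have "(G \<longlongrightarrow> (\<Sum>x\<in>A. w x * l x * ln (l x)) - (\<Sum>y\<in>B. w' y * l' y * ln (l' y))) at_top"
    by simp
  from tendsto_lowerbound[OF this ev] show ?thesis by (simp add: G_def)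
qed

text \<open>Completing the square. The supremum over \<open>y\<close> is the pointwise form of the
  variational formula for \<open>F_t\<close>; for \<open>r = 0\<close> both sides are 0, the right
  one by the convention for division.\<close>

lemma quadratic_bound:
  fixes s y :: complex and r :: real
  assumes "0 \<le> r" "r = 0 \<Longrightarrow> s = 0"
  shows "2 * Re (cnj s * y) - r * (cmod y)\<^sup>2 \<le> (cmod s)\<^sup>2 / r"
proof (cases "r = 0")
  case False
  then have r: "0 < r" using assms by simp
  have "0 \<le> (cmod (s - complex_of_real r * y))\<^sup>2" by simp
  also have "\<dots> = (cmod s)\<^sup>2 - 2 * r * Re (cnj s * y) + r\<^sup>2 * (cmod y)\<^sup>2"
    unfolding cmod_power2 by (simp add: power2_eq_square algebra_simps)
  finally show ?thesis using r by (simp add: field_simps power2_eq_square)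
qed (use assms in auto)

text \<open>The bound is attained at \<open>y = s / r\<close>; division by zero makes this hold for
  \<open>r = 0\<close> as well.\<close>

lemma quadratic_bound_eq:
  fixes s :: complex and r :: real
  shows "2 * Re (cnj s * (s / complex_of_real r)) - r * (cmod (s / complex_of_real r))\<^sup>2 = (cmod s)\<^sup>2 / r"
proof (cases "r = 0")
  case False
  have "Re (cnj s * (s / complex_of_real r)) = (cmod s)\<^sup>2 / r"
    unfolding cmod_power2 by (simp add: power2_eq_square add_divide_distrib)
  moreover have "r * (cmod (s / complex_of_real r))\<^sup>2 = (cmod s)\<^sup>2 / r"
    using False by (simp add: norm_divide power_divide power2_eq_square)
  ultimately show ?thesis by linarith
qed auto

text \<open>Arranged for \<open>log_comparison\<close> over pairs \<open>(x, i)\<close> with weights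
  \<open>|u_i(x)|^2\<close>. Moving the sums over \<open>p\<close> and \<open>m\<close> across gives
  monotonicity of \<open>C_r\<close>, up to the factor \<open>ln 2\<close>.\<close>

theorem coherence_sum_ptrace_le:
  assumes es: "eigensystem (d * k) A l u" and eb: "eigensystem k (ptrace d k A) m v"
  defines "p x \<equiv> Re (A $$ (x, x))" and "q b \<equiv> Re (ptrace d k A $$ (b, b))"
  shows "(\<Sum>x<d * k. p x * ln (p x)) - (\<Sum>b<k. q b * ln (q b))
    \<le> (\<Sum>i<d * k. l i * ln (l i)) - (\<Sum>j<k. m j * ln (m j))"
proof -
  define n where "n = d * k"
  note es = es[folded n_def]
  have p: "p x = (\<Sum>i<n. l i * (cmod (u i x))\<^sup>2)" if "x < n" for x
    using eigensystem_diag[OF es that] by (simp add: p_def)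
  have q: "q b = (\<Sum>j<k. m j * (cmod (v j b))\<^sup>2)" if "b < k" for b
    using eigensystem_diag[OF eb that] by (simp add: q_def)
  have pq: "q b = (\<Sum>a<d. p (a * k + b))" if "b < k" for b
    using that by (simp add: p_def q_def ptrace_diag)
  have l: "0 \<le> l i" if "i < n" for i using eigensystem_nonneg[OF es that] .
  have m: "0 \<le> m j" if "j < k" for j using eigensystem_nonneg[OF eb that] .
  have p0: "0 \<le> p x" if "x < n" for x using l by (auto simp: p[OF that] intro!: sum_nonneg)
  have q0: "0 \<le> q b" if "b < k" for b using m by (auto simp: q[OF that] intro!: sum_nonneg)
  have supp: "l i = 0 \<or> u i x = 0" if "x < n" "i < n" "p x = 0" for x i
    using that l unfolding p[OF that(1)] by (subst (asm) sum_nonneg_eq_0_iff) auto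
  have supp': "m j = 0 \<or> v j b = 0" if "b < k" "j < k" "q b = 0" for b j
    using that m unfolding q[OF that(1)] by (subst (asm) sum_nonneg_eq_0_iff) auto
  \<comment> \<open>Summing the weighted eigenvalues over \<open>i\<close> produces the diagonal; in
    \<open>marg'\<close> and \<open>marg''\<close> the sum over positions recovers the
    spectrum.\<close>
  have marg: "(\<Sum>x<n. \<Sum>i<n. (cmod (u i x))\<^sup>2 * l i * h x) = (\<Sum>x<n. p x * h x)"
    "(\<Sum>b<k. \<Sum>j<k. (cmod (v j b))\<^sup>2 * m j * h b) = (\<Sum>b<k. q b * h b)" for h :: "nat \<Rightarrow> real"
    by (simp_all add: p q sum_distrib_right sum_distrib_left mult_ac)
  have marg': "(\<Sum>x<n. \<Sum>i<n. (cmod (u i x))\<^sup>2 * l i * h i) = (\<Sum>i<n. l i * h i)" for h :: "nat \<Rightarrow> real"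
  proof -
    have "(\<Sum>x<n. \<Sum>i<n. (cmod (u i x))\<^sup>2 * l i * h i) = (\<Sum>i<n. (\<Sum>x<n. (cmod (u i x))\<^sup>2) * (l i * h i))"
      unfolding sum_distrib_right by (subst sum.swap) (simp add: mult_ac)
    then show ?thesis using eigensystem_unit[OF es] by simp
  qed
  have marg'': "(\<Sum>b<k. \<Sum>j<k. (cmod (v j b))\<^sup>2 * m j * h j) = (\<Sum>j<k. m j * h j)" for h :: "nat \<Rightarrow> real"
  proof -
    have "(\<Sum>b<k. \<Sum>j<k. (cmod (v j b))\<^sup>2 * m j * h j) = (\<Sum>j<k. (\<Sum>b<k. (cmod (v j b))\<^sup>2) * (m j * h j))"
      unfolding sum_distrib_right by (subst sum.swap) (simp add: mult_ac)
    then show ?thesis using eigensystem_unit[OF eb] by simp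
  qed
  have key: "(\<Sum>b<k. \<Sum>j<k. (cmod (v j b))\<^sup>2 * ((m j)\<^sup>2 / (q b + t * m j)))
    \<le> (\<Sum>x<n. \<Sum>i<n. (cmod (u i x))\<^sup>2 * ((l i)\<^sup>2 / (p x + t * l i)))" if t: "0 \<le> t" for t
  proof -
    \<comment> \<open>\<open>y\<close> is the optimal \<open>X\<close> for the reduced state, in the basis \<open>v\<close>; \<open>cnj (\<xi> b b')\<close> are its matrix entries
      and \<open>z\<close> is \<open>\<one> \<otimes> X\<close> in the basis \<open>u\<close>.\<close>
    define y where "y b j = complex_of_real (m j) * v j b / complex_of_real (q b + t * m j)" for b j
    define \<xi> where "\<xi> b b' = (\<Sum>j<k. cnj (y b j) * v j b')" for b b'
    define z where "z a b i = ip k (\<xi> b) (block k a (u i))" for a b i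
    have \<xi>v: "ip k (v j) (\<xi> b) = cnj (y b j)" if "j < k" for j b
      unfolding \<xi>_def using ip_orthonormal_expansion[OF eigensystem_orthonormal[OF eb] that] .
    then have v\<xi>: "ip k (\<xi> b) (v j) = y b j" if "j < k" for j b
      using that cnj_ip[of k "v j" "\<xi> b"] by simp
    \<comment> \<open>Both sides are the real part of \<open><\<xi> b, A^B e_b>\<close>, expanded
      once over the blocks of the \<open>u i\<close> and once over the \<open>v j\<close>.\<close>
    have I1: "(\<Sum>a<d. \<Sum>i<n. l i * Re (cnj (u i (a * k + b)) * z a b i))
      = (\<Sum>j<k. m j * Re (cnj (v j b) * y b j))" if b: "b < k" for b
    proof -
      define e where "e b' = (of_bool (b' = b) :: complex)" for b'
      have ie: "ip k f e = cnj (f b)" for f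
        using b by (simp add: ip_def e_def of_bool_def if_distrib sum.delta cong: if_cong)
      have "(\<Sum>a<d. \<Sum>i<n. complex_of_real (l i) * (z a b i * cnj (u i (a * k + b))))
          = (\<Sum>j<k. complex_of_real (m j) * (y b j * cnj (v j b)))"
        using ptrace_form[OF es[unfolded n_def], of "\<xi> b" e] eigensystem_form[OF eb, of "\<xi> b" e]
        by (simp add: ie v\<xi> z_def block_def n_def)
      from arg_cong[OF this, of Re] show ?thesis by (simp add: mult_ac)
    qed
    \<comment> \<open>\<open>\<zeta>\<close> places \<open>\<xi> b\<close> into block
      \<open>a\<close>. Parseval in the basis \<open>u\<close> and then in \<open>v\<close> computes
      the same norm.\<close>
    have I2: "(\<Sum>i<n. (cmod (z a b i))\<^sup>2) = (\<Sum>j<k. (cmod (y b j))\<^sup>2)" if a: "a < d" for a b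
    proof -
      define \<zeta> where "\<zeta> x = (if x div k = a then \<xi> b (x mod k) else 0)" for x
      have bl: "block k a' \<zeta> b' = (if a' = a then \<xi> b b' else 0)" if "b' < k" for a' b'
        using that by (simp add: block_def \<zeta>_def)
      have 1: "ip n \<zeta> f = ip k (\<xi> b) (block k a f)" for f
      proof -
        have "ip n \<zeta> f = (\<Sum>a'<d. if a' = a then ip k (\<xi> b) (block k a f) else 0)"
          unfolding n_def ip_block by (intro sum.cong refl) (auto simp: ip_def bl)
        then show ?thesis using a by simp
      qed
      have 2: "ip n \<zeta> \<zeta> = ip k (\<xi> b) (\<xi> b)"
        unfolding 1 by (intro ip_cong) (auto simp: bl)
      have "(\<Sum>i<n. (cmod (z a b i))\<^sup>2) = (\<Sum>i<n. (cmod (ip n (u i) \<zeta>))\<^sup>2)"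
        by (simp add: z_def 1 cmod_ip_commute[of n _ \<zeta>])
      also have "\<dots> = (\<Sum>x<n. (cmod (\<zeta> x))\<^sup>2)" by (rule eigensystem_parseval_norm[OF es])
      also have "\<dots> = (\<Sum>x<k. (cmod (\<xi> b x))\<^sup>2)" using 2 unfolding ip_self by (simp only: of_real_eq_iff)
      also have "\<dots> = (\<Sum>j<k. (cmod (ip k (v j) (\<xi> b)))\<^sup>2)" by (rule eigensystem_parseval_norm[OF eb, symmetric])
      also have "\<dots> = (\<Sum>j<k. (cmod (y b j))\<^sup>2)" by (simp add: \<xi>v)
      finally show ?thesis .
    qed
    have I2': "(\<Sum>a<d. p (a * k + b) * (\<Sum>i<n. (cmod (z a b i))\<^sup>2)) = q b * (\<Sum>j<k. (cmod (y b j))\<^sup>2)"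
      if "b < k" for b
      using that by (simp add: pq sum_distrib_right I2)
    \<comment> \<open>The form of the reduced matrix at \<open>\<xi> b\<close>, expanded in the two
      eigensystems.\<close>
    have I3: "(\<Sum>a<d. \<Sum>i<n. l i * (cmod (z a b i))\<^sup>2) = (\<Sum>j<k. m j * (cmod (y b j))\<^sup>2)" for b
    proof -
      have "complex_of_real (\<Sum>a<d. \<Sum>i<n. l i * (cmod (z a b i))\<^sup>2) = ip k (\<xi> b) (mat_app k (ptrace d k A) (\<xi> b))"
        unfolding ptrace_form[OF es[unfolded n_def]] ip_mult_ip_swap
        by (simp add: z_def cmod_ip_commute[of k "\<xi> b"] n_def)
      also have "\<dots> = complex_of_real (\<Sum>j<k. m j * (cmod (y b j))\<^sup>2)"
        unfolding eigensystem_form[OF eb] ip_mult_ip_swap by (simp add: \<xi>v)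
      finally show ?thesis by (simp only: of_real_eq_iff)
    qed
    \<comment> \<open>On the reduced side \<open>y\<close> is optimal, so equality holds.\<close>
    have "(\<Sum>b<k. \<Sum>j<k. (cmod (v j b))\<^sup>2 * ((m j)\<^sup>2 / (q b + t * m j)))
        = (\<Sum>b<k. \<Sum>j<k. 2 * (m j * Re (cnj (v j b) * y b j)) - (q b + t * m j) * (cmod (y b j))\<^sup>2)"
    proof (intro sum.cong refl)
      fix b j assume "b \<in> {..<k}" "j \<in> {..<k}"
      show "(cmod (v j b))\<^sup>2 * ((m j)\<^sup>2 / (q b + t * m j))
          = 2 * (m j * Re (cnj (v j b) * y b j)) - (q b + t * m j) * (cmod (y b j))\<^sup>2"
        using quadratic_bound_eq[of "complex_of_real (m j) * v j b" "q b + t * m j"]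
        unfolding y_def[symmetric] by (simp add: norm_mult power_mult_distrib algebra_simps)
    qed
    also have "\<dots> = (\<Sum>b<k. 2 * (\<Sum>j<k. m j * Re (cnj (v j b) * y b j))
        - q b * (\<Sum>j<k. (cmod (y b j))\<^sup>2) - t * (\<Sum>j<k. m j * (cmod (y b j))\<^sup>2))"
      by (simp add: sum_subtractf sum.distrib sum_distrib_left algebra_simps)
    also have "\<dots> = (\<Sum>b<k. 2 * (\<Sum>a<d. \<Sum>i<n. l i * Re (cnj (u i (a * k + b)) * z a b i))
        - (\<Sum>a<d. p (a * k + b) * (\<Sum>i<n. (cmod (z a b i))\<^sup>2)) - t * (\<Sum>a<d. \<Sum>i<n. l i * (cmod (z a b i))\<^sup>2))"
      by (intro sum.cong refl) (simp only: I1 I2' I3 lessThan_iff)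
    also have "\<dots> = (\<Sum>b<k. \<Sum>a<d. \<Sum>i<n. 2 * (l i * Re (cnj (u i (a * k + b)) * z a b i))
        - (p (a * k + b) + t * l i) * (cmod (z a b i))\<^sup>2)"
      by (simp add: sum_subtractf sum.distrib sum_distrib_left algebra_simps)
    \<comment> \<open>On the full system \<open>z\<close> is merely one candidate, so
      \<open>quadratic_bound\<close> gives an inequality.\<close>
    also have "\<dots> \<le> (\<Sum>b<k. \<Sum>a<d. \<Sum>i<n. (cmod (u i (a * k + b)))\<^sup>2 * ((l i)\<^sup>2 / (p (a * k + b) + t * l i)))"
    proof (intro sum_mono)
      fix b a i assume "b \<in> {..<k}" "a \<in> {..<d}" "i \<in> {..<n}"
      then have x: "a * k + b < n" and i: "i < n" by (auto simp: n_def block_index_less)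
      have nn: "0 \<le> t * l i" using t l[OF i] by simp
      \<comment> \<open>A zero denominator forces \<open>p = 0\<close>, and then the support
        condition removes the numerator.\<close>
      have z0: "complex_of_real (l i) * u i (a * k + b) = 0" if "p (a * k + b) + t * l i = 0"
        using supp[OF x i] that nn p0[OF x] by (auto simp: add_nonneg_eq_0_iff)
      show "2 * (l i * Re (cnj (u i (a * k + b)) * z a b i)) - (p (a * k + b) + t * l i) * (cmod (z a b i))\<^sup>2
          \<le> (cmod (u i (a * k + b)))\<^sup>2 * ((l i)\<^sup>2 / (p (a * k + b) + t * l i))"
        using quadratic_bound[of "p (a * k + b) + t * l i" "complex_of_real (l i) * u i (a * k + b)" "z a b i", OF _ z0]
          nn p0[OF x]
        by (simp add: norm_mult power_mult_distrib algebra_simps)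
    qed
    also have "\<dots> = (\<Sum>x<n. \<Sum>i<n. (cmod (u i x))\<^sup>2 * ((l i)\<^sup>2 / (p x + t * l i)))"
      unfolding n_def sum_over_blocks[of _ d k] by (subst sum.swap) (rule refl)
    finally show ?thesis .
  qed
  have tot: "(\<Sum>x<n. p x) = (\<Sum>b<k. q b)"
    by (simp add: n_def sum_over_blocks pq) (rule sum.swap)
  have "(\<Sum>z\<in>{..<n} \<times> {..<n}. (cmod (u (snd z) (fst z)))\<^sup>2 * l (snd z) * ln (p (fst z)))
      - (\<Sum>z\<in>{..<k} \<times> {..<k}. (cmod (v (snd z) (fst z)))\<^sup>2 * m (snd z) * ln (q (fst z)))
    \<le> (\<Sum>z\<in>{..<n} \<times> {..<n}. (cmod (u (snd z) (fst z)))\<^sup>2 * l (snd z) * ln (l (snd z)))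
      - (\<Sum>z\<in>{..<k} \<times> {..<k}. (cmod (v (snd z) (fst z)))\<^sup>2 * m (snd z) * ln (m (snd z)))"
  proof (rule log_comparison)
    show "(\<Sum>z\<in>{..<n} \<times> {..<n}. (cmod (u (snd z) (fst z)))\<^sup>2 * l (snd z))
        = (\<Sum>z\<in>{..<k} \<times> {..<k}. (cmod (v (snd z) (fst z)))\<^sup>2 * m (snd z))"
      unfolding sum.cartesian_product' fst_conv snd_conv
      using marg[of "\<lambda>_. 1"] tot by simp
    show "(\<Sum>z\<in>{..<k} \<times> {..<k}. (cmod (v (snd z) (fst z)))\<^sup>2 * ((m (snd z))\<^sup>2 / (q (fst z) + t * m (snd z))))
      \<le> (\<Sum>z\<in>{..<n} \<times> {..<n}. (cmod (u (snd z) (fst z)))\<^sup>2 * ((l (snd z))\<^sup>2 / (p (fst z) + t * l (snd z))))"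
      if "0 \<le> t" for t
      unfolding sum.cartesian_product' fst_conv snd_conv by (rule key[OF that])
    show "(cmod (u (snd z) (fst z)))\<^sup>2 * l (snd z) = 0" if "z \<in> {..<n} \<times> {..<n}" "p (fst z) = 0" for z
      using supp[of "fst z" "snd z"] that by auto
    show "(cmod (v (snd z) (fst z)))\<^sup>2 * m (snd z) = 0" if "z \<in> {..<k} \<times> {..<k}" "q (fst z) = 0" for z
      using supp'[of "fst z" "snd z"] that by auto
  qed (use l m p0 q0 in \<open>auto simp: mem_Times_iff\<close>)
  then show ?thesis
    unfolding sum.cartesian_product' fst_conv snd_conv marg marg' marg'' unfolding n_def .
qed

section \<open>Conditional entropies\<close>

text \<open>The operator inequality \<open>A \<le> c (\<one> \<otimes> A\<^sup>B)\<close>.\<close>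

definition reduction_dominated :: "nat \<Rightarrow> nat \<Rightarrow> real \<Rightarrow> complex mat \<Rightarrow> bool" where
  "reduction_dominated d k c A \<longleftrightarrow> (\<forall>f. Re (ip (d * k) f (mat_app (d * k) A f))
    \<le> c * (\<Sum>a<d. Re (ip k (block k a f) (mat_app k (ptrace d k A) (block k a f)))))"

text \<open>The bound \<open>ln r \<le> r - 1\<close> at \<open>r = l / (c * m)\<close>, weighted by
  \<open>l * w\<close>.\<close>

lemma gibbs_term_scaled:
  fixes w l m c :: real
  assumes "0 \<le> w" "0 \<le> l" "0 \<le> m" "0 < c" and supp: "m = 0 \<Longrightarrow> l * w = 0"
  shows "l * w * (ln l - ln c - ln m) \<le> l / c * (l * (w / m)) - l * w"
proof (cases "l * w = 0")
  case False
  then have pos: "0 < l" "0 < w" "0 < m" using assms by (auto simp: less_le)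
  have "ln (l / (c * m)) \<le> l / (c * m) - 1" using pos assms by (intro ln_le_minus_one) auto
  moreover have "ln (l / (c * m)) = ln l - ln c - ln m" using pos assms by (simp add: ln_div ln_mult)
  ultimately have "l * w * (ln l - ln c - ln m) \<le> l * w * (l / (c * m) - 1)"
    using pos by (intro mult_left_mono) auto
  also have "\<dots> = l / c * (l * (w / m)) - l * w" by (simp add: algebra_simps)
  finally show ?thesis .
qed auto

text \<open>A Gibbs inequality for \<open>S(A|B)\<close> in natural units. Here
  \<open>w i a j\<close> is the transition probability from \<open>u i\<close> to the product vector
  \<open>|a> v_j\<close>, an eigenvector of \<open>1 tensor A^B\<close>. The remainder is controlled
  by \<open>l_i <u_i, (1 tensor A^B)^-1 u_i> \<le> c\<close>, with the inverse taken on the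
  support.\<close>

theorem entropy_sum_ptrace_le:
  assumes es: "eigensystem (d * k) A l u" and eb: "eigensystem k (ptrace d k A) m v"
    and dom: "reduction_dominated d k c A" and c: "0 < c" and total: "(\<Sum>i<d * k. l i) = 1"
  shows "(\<Sum>i<d * k. l i * ln (l i)) - (\<Sum>j<k. m j * ln (m j)) \<le> ln c"
proof -
  define n where "n = d * k"
  note es = es[folded n_def] and total = total[folded n_def]
  define C where "C i a j = ip k (v j) (block k a (u i))" for i a j
  define w where "w i a j = (cmod (C i a j))\<^sup>2" for i a j
  have w0: "0 \<le> w i a j" for i a j by (simp add: w_def)
  have l: "0 \<le> l i" if "i < n" for i using eigensystem_nonneg[OF es that] .
  have m: "0 \<le> m j" if "j < k" for j using eigensystem_nonneg[OF eb that] .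
  have w_sum: "(\<Sum>a<d. \<Sum>j<k. w i a j) = 1" if "i < n" for i
  proof -
    have "(\<Sum>a<d. \<Sum>j<k. w i a j) = (\<Sum>a<d. \<Sum>b<k. (cmod (block k a (u i) b))\<^sup>2)"
      unfolding w_def C_def eigensystem_parseval_norm[OF eb] ..
    also have "\<dots> = (\<Sum>x<n. (cmod (u i x))\<^sup>2)"
      by (simp add: n_def sum_over_blocks block_def)
    finally show ?thesis using eigensystem_unit[OF es that] by simp
  qed
  \<comment> \<open>Both sides are the diagonal entry of the reduced matrix at its eigenvector
    \<open>v j\<close>.\<close>
  have w_marg: "(\<Sum>i<n. \<Sum>a<d. l i * w i a j) = m j" if j: "j < k" for j
  proof -
    have "complex_of_real (\<Sum>a<d. \<Sum>i<n. l i * w i a j) = ip k (v j) (mat_app k (ptrace d k A) (v j))"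
      unfolding ptrace_form[OF es[unfolded n_def]] ip_mult_ip_swap w_def C_def
      by (simp add: cmod_ip_commute[of k "v j"] n_def)
    also have "\<dots> = (\<Sum>j'<k. if j' = j then complex_of_real (m j) else 0)"
      unfolding eigensystem_form[OF eb] using j
      by (intro sum.cong refl) (auto simp: eigensystem_orthonormal[OF eb])
    also have "\<dots> = complex_of_real (m j)" using j by simp
    finally have "(\<Sum>a<d. \<Sum>i<n. l i * w i a j) = m j" by (simp only: of_real_eq_iff)
    then show ?thesis by (subst sum.swap)
  qed
  have supp: "l i * w i a j = 0" if "i < n" "a < d" "j < k" "m j = 0" for i a j
  proof -
    have "l i * w i a j \<le> (\<Sum>a<d. l i * w i a j)"
      using that l w0 by (intro member_le_sum) auto
    also have "\<dots> \<le> (\<Sum>i<n. \<Sum>a<d. l i * w i a j)"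
      using that l w0 by (intro member_le_sum[of i "{..<n}" "\<lambda>i. \<Sum>a<d. l i * w i a j"] sum_nonneg) auto
    finally show ?thesis using w_marg[OF that(3)] that l w0 by (metis mult_nonneg_nonneg order_antisym)
  qed
  \<comment> \<open>Domination is tested at the vector \<open>z\<close>. Since
    \<open><u_i, z>\<close> and \<open><z, (1 tensor A^B) z>\<close> both equal \<open>S\<close>, it
    gives \<open>l i * S^2 \<le> c * S\<close>.\<close>
  have bound: "l i * (\<Sum>a<d. \<Sum>j<k. w i a j / m j) \<le> c" if i: "i < n" for i
  proof -
    define S where "S = (\<Sum>a<d. \<Sum>j<k. w i a j / m j)"
    \<comment> \<open>\<open>z = (\<one> \<otimes> \<rho>\<^sup>B)\<^sup>-\<^sup>1 u\<^sub>i\<close>, where the kernel is dropped because \<open>x / 0 = 0\<close>.\<close>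
    define z where "z x = (\<Sum>j<k. C i (x div k) j / complex_of_real (m j) * v j (x mod k))" for x
    have bz: "block k a z b = (\<Sum>j<k. C i a j / complex_of_real (m j) * v j b)" if "b < k" for a b
      using that by (simp add: block_def z_def)
    have ipz: "ip k f (block k a z) = ip k f (\<lambda>b. \<Sum>j<k. C i a j / complex_of_real (m j) * v j b)" for f a
      by (intro ip_cong) (auto simp: bz)
    have "ip n (u i) z = (\<Sum>a<d. \<Sum>j<k. C i a j / complex_of_real (m j) * cnj (C i a j))"
      unfolding n_def ip_block ipz ip_sum_right by (simp add: C_def cnj_ip)
    also have "\<dots> = complex_of_real S"
      unfolding S_def w_def of_real_sum of_real_divide complex_norm_square by simp
    finally have uz: "ip n (u i) z = complex_of_real S" .
    have "l i * S\<^sup>2 = l i * (cmod (ip n (u i) z))\<^sup>2" by (simp add: uz)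
    also have "\<dots> \<le> (\<Sum>i<n. l i * (cmod (ip n (u i) z))\<^sup>2)"
      using i l by (intro member_le_sum) auto
    also have "\<dots> = Re (ip n z (mat_app n A z))" by (rule eigensystem_quadratic_form[OF es, symmetric])
    also have "\<dots> \<le> c * (\<Sum>a<d. Re (ip k (block k a z) (mat_app k (ptrace d k A) (block k a z))))"
      using dom unfolding reduction_dominated_def n_def by blast
    also have "(\<Sum>a<d. Re (ip k (block k a z) (mat_app k (ptrace d k A) (block k a z)))) = S"
      unfolding eigensystem_quadratic_form[OF eb] S_def
    proof (intro sum.cong refl)
      fix a j assume "j \<in> {..<k}"
      then have "ip k (v j) (block k a z) = C i a j / complex_of_real (m j)"
        unfolding ipz by (intro ip_orthonormal_expansion eigensystem_orthonormal[OF eb]) simp_all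
      \<comment> \<open>For \<open>m j = 0\<close> both sides vanish, the right one by division by
        zero.\<close>
      then show "m j * (cmod (ip k (v j) (block k a z)))\<^sup>2 = w i a j / m j"
        by (simp add: w_def norm_divide power_divide power2_eq_square)
    qed
    finally have "(l i * S) * S \<le> c * S" by (simp add: power2_eq_square mult.assoc)
    moreover have "0 \<le> S" unfolding S_def using w0 m by (intro sum_nonneg) auto
    ultimately have "l i * S \<le> c" using c by (cases "S = 0") auto
    then show ?thesis by (simp add: S_def)
  qed
  have "(\<Sum>i<n. \<Sum>a<d. \<Sum>j<k. l i * w i a j * (ln (l i) - ln c - ln (m j)))
      \<le> (\<Sum>i<n. \<Sum>a<d. \<Sum>j<k. l i / c * (l i * (w i a j / m j)) - l i * w i a j)"
    using l m w0 c supp by (intro sum_mono gibbs_term_scaled) auto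
  also have "\<dots> = (\<Sum>i<n. l i / c * (l i * (\<Sum>a<d. \<Sum>j<k. w i a j / m j)) - l i * (\<Sum>a<d. \<Sum>j<k. w i a j))"
    by (simp only: sum_subtractf sum_distrib_left)
  also have "\<dots> \<le> (\<Sum>i<n. 0)"
  proof (intro sum_mono)
    fix i assume "i \<in> {..<n}"
    then have i: "i < n" by simp
    have "l i / c * (l i * (\<Sum>a<d. \<Sum>j<k. w i a j / m j)) \<le> l i / c * c"
      using bound[OF i] l[OF i] c by (intro mult_left_mono) auto
    then show "l i / c * (l i * (\<Sum>a<d. \<Sum>j<k. w i a j / m j)) - l i * (\<Sum>a<d. \<Sum>j<k. w i a j) \<le> 0"
      using w_sum[OF i] c by simp
  qed
  finally have "(\<Sum>i<n. \<Sum>a<d. \<Sum>j<k. l i * w i a j * (ln (l i) - ln c))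
      - (\<Sum>i<n. \<Sum>a<d. \<Sum>j<k. l i * w i a j * ln (m j)) \<le> 0"
    by (simp add: right_diff_distrib sum_subtractf)
  moreover have "(\<Sum>i<n. \<Sum>a<d. \<Sum>j<k. l i * w i a j * (ln (l i) - ln c)) = (\<Sum>i<n. l i * ln (l i)) - ln c"
  proof -
    have "(\<Sum>i<n. \<Sum>a<d. \<Sum>j<k. l i * w i a j * (ln (l i) - ln c))
        = (\<Sum>i<n. l i * (\<Sum>a<d. \<Sum>j<k. w i a j) * (ln (l i) - ln c))"
      by (simp only: sum_distrib_left sum_distrib_right)
    also have "\<dots> = (\<Sum>i<n. l i * ln (l i)) - (\<Sum>i<n. l i) * ln c"
      using w_sum by (simp add: right_diff_distrib sum_subtractf sum_distrib_right)
    finally show ?thesis using total by simp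
  qed
  moreover have "(\<Sum>i<n. \<Sum>a<d. \<Sum>j<k. l i * w i a j * ln (m j)) = (\<Sum>j<k. m j * ln (m j))"
  proof -
    have "(\<Sum>i<n. \<Sum>a<d. \<Sum>j<k. l i * w i a j * ln (m j)) = (\<Sum>i<n. \<Sum>j<k. \<Sum>a<d. l i * w i a j * ln (m j))"
      by (intro sum.cong refl sum.swap)
    also have "\<dots> = (\<Sum>j<k. \<Sum>i<n. \<Sum>a<d. l i * w i a j * ln (m j))"
      by (rule sum.swap)
    also have "\<dots> = (\<Sum>j<k. (\<Sum>i<n. \<Sum>a<d. l i * w i a j) * ln (m j))"
      by (simp only: sum_distrib_right)
    finally show ?thesis using w_marg by simp
  qed
  ultimately show ?thesis by (simp add: n_def)
qed

section \<open>Cauchy-Schwarz and the domination constant of a general state\<close>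

lemma unit_ip_le_norm:
  assumes "ip n g g = 1"
  shows "(cmod (ip n g f))\<^sup>2 \<le> (\<Sum>x<n. (cmod (f x))\<^sup>2)"
proof -
  define s where "s = ip n g f"
  \<comment> \<open>\<open>h\<close> is \<open>f\<close> without its component along
    \<open>g\<close>; its squared norm is \<open>|f|^2 - |s|^2\<close>.\<close>
  define h where "h x = f x + (- s) * g x" for x
  have gf: "ip n f g = cnj s" by (simp add: s_def cnj_ip)
  have "0 \<le> Re (ip n h h)" unfolding ip_self by (simp add: sum_nonneg)
  also have "ip n h h = ip n h f + (- s) * ip n h g"
    unfolding h_def[abs_def] ip_add_right ip_scale_right ..
  also have "ip n h f = ip n f f - cnj s * s"
  proof -
    have "ip n h f = cnj (ip n f h)" by (simp add: cnj_ip)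
    also have "ip n f h = ip n f f + (- s) * cnj s"
      unfolding h_def[abs_def] ip_add_right ip_scale_right gf ..
    finally show ?thesis by (simp add: cnj_ip)
  qed
  also have "ip n h g = 0"
  proof -
    have "ip n g h = 0"
      unfolding h_def[abs_def] ip_add_right ip_scale_right assms s_def by simp
    then show ?thesis using cnj_ip[of n g h] by simp
  qed
  also have "cnj s * s = complex_of_real ((cmod s)\<^sup>2)" unfolding complex_norm_square by simp
  finally show ?thesis unfolding ip_self s_def by simp
qed

lemma norm_sum_squared_le:
  assumes "1 \<le> d"
  shows "(cmod (\<Sum>a<d. z a))\<^sup>2 \<le> real d * (\<Sum>a<d. (cmod (z a))\<^sup>2)"
proof -
  \<comment> \<open>\<open>r\<close> normalises the constant vector of dimension \<open>d\<close>;
    Cauchy-Schwarz against it yields the factor \<open>d\<close>.\<close>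
  define r where "r = 1 / sqrt (real d)"
  have r: "real d * (r * r) = 1" using assms by (simp add: r_def)
  have "ip d (\<lambda>_. complex_of_real r) (\<lambda>_. complex_of_real r) = complex_of_real (real d * (r * r))"
    by (simp add: ip_def)
  then have "ip d (\<lambda>_. complex_of_real r) (\<lambda>_. complex_of_real r) = 1" using r by simp
  from unit_ip_le_norm[OF this, of z]
  have "(cmod (complex_of_real r * (\<Sum>a<d. z a)))\<^sup>2 \<le> (\<Sum>a<d. (cmod (z a))\<^sup>2)"
    by (simp add: ip_def sum_distrib_left)
  then have "(r * r) * (cmod (\<Sum>a<d. z a))\<^sup>2 \<le> (\<Sum>a<d. (cmod (z a))\<^sup>2)"
    by (simp add: norm_mult power_mult_distrib flip: power2_eq_square)
  then have "real d * ((r * r) * (cmod (\<Sum>a<d. z a))\<^sup>2) \<le> real d * (\<Sum>a<d. (cmod (z a))\<^sup>2)"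
    by (intro mult_left_mono) auto
  then show ?thesis using r by (simp flip: mult.assoc)
qed

text \<open>Each \<open><u_i, f>\<close> is a sum of \<open>d\<close> scalar products of matching
  blocks, which costs the factor \<open>d\<close> in Cauchy-Schwarz.\<close>

lemma psd_reduction_dominated:
  assumes "1 \<le> d" and A: "psd (d * k) A"
  shows "reduction_dominated d k (real d) A"
  unfolding reduction_dominated_def
proof
  fix f
  define n where "n = d * k"
  obtain l u where es: "eigensystem n A l u" using psd_eigensystem A unfolding n_def by blast
  have l: "0 \<le> l i" if "i < n" for i using eigensystem_nonneg[OF es that] .
  define N where "N i a a' = (cmod (ip k (block k a' (u i)) (block k a f)))\<^sup>2" for i a a'
  have "Re (ip n f (mat_app n A f)) = (\<Sum>i<n. l i * (cmod (\<Sum>a<d. ip k (block k a (u i)) (block k a f)))\<^sup>2)"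
    unfolding eigensystem_quadratic_form[OF es] unfolding n_def ip_block ..
  also have "\<dots> \<le> (\<Sum>i<n. l i * (real d * (\<Sum>a<d. N i a a)))"
    unfolding N_def using l assms by (intro sum_mono mult_left_mono norm_sum_squared_le) auto
  \<comment> \<open>Only pairs of blocks with \<open>a = a'\<close> occur so far; the added mixed
    terms are nonnegative and complete the form of \<open>1 tensor A^B\<close>.\<close>
  also have "\<dots> \<le> (\<Sum>i<n. l i * (real d * (\<Sum>a<d. \<Sum>a'<d. N i a a')))"
    using l by (intro sum_mono mult_left_mono member_le_sum[of _ "{..<d}" "N _ _"]) (auto simp: N_def)
  also have "\<dots> = real d * (\<Sum>a<d. \<Sum>a'<d. \<Sum>i<n. l i * N i a a')"
  proof -
    have "(\<Sum>i<n. l i * (\<Sum>a<d. \<Sum>a'<d. N i a a')) = (\<Sum>a<d. \<Sum>i<n. \<Sum>a'<d. l i * N i a a')"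
      unfolding sum_distrib_left by (rule sum.swap)
    also have "\<dots> = (\<Sum>a<d. \<Sum>a'<d. \<Sum>i<n. l i * N i a a')"
      by (intro sum.cong refl sum.swap)
    finally have *: "(\<Sum>i<n. l i * (\<Sum>a<d. \<Sum>a'<d. N i a a')) = (\<Sum>a<d. \<Sum>a'<d. \<Sum>i<n. l i * N i a a')" .
    have "(\<Sum>i<n. l i * (real d * (\<Sum>a<d. \<Sum>a'<d. N i a a')))
        = real d * (\<Sum>i<n. l i * (\<Sum>a<d. \<Sum>a'<d. N i a a'))"
      unfolding sum_distrib_left[of "real d" _ "{..<n}"] by (intro sum.cong refl) (rule mult.left_commute)
    then show ?thesis unfolding * .
  qed
  also have "(\<Sum>a<d. \<Sum>a'<d. \<Sum>i<n. l i * N i a a')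
      = (\<Sum>a<d. Re (ip k (block k a f) (mat_app k (ptrace d k A) (block k a f))))"
    unfolding ptrace_form[OF es[unfolded n_def]] ip_mult_ip_swap N_def n_def
    by (simp flip: of_real_mult of_real_power of_real_sum)
  finally show "Re (ip (d * k) f (mat_app (d * k) A f))
      \<le> real d * (\<Sum>a<d. Re (ip k (block k a f) (mat_app k (ptrace d k A) (block k a f))))"
    by (simp only: n_def)
qed

section \<open>Coherence in terms of eigensystems\<close>

lemma mat_adjoint_index:
  assumes "U \<in> carrier_mat n n" "i < n" "x < n"
  shows "mat_adjoint U $$ (i, x) = cnj (U $$ (x, i))"
  using assms by (simp add: mat_adjoint_def mat_of_rows_def)

text \<open>The matrix with columns \<open>u i\<close> diagonalises \<open>A\<close>, so
  \<open>mat_fun_eqI\<close> evaluates the logarithm, and cyclicity of the trace removes the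
  unitaries.\<close>

lemma vn_entropy_eigensystem:
  assumes A: "A \<in> carrier_mat n n" and es: "eigensystem n A l u"
  shows "vn_entropy A = - (\<Sum>i<n. l i * log 2 (l i))"
proof -
  define U where "U = mat n n (\<lambda>(x, i). u i x)"
  define V where "V = mat_adjoint U"
  define D where "D f = mat_diag n (\<lambda>i. complex_of_real (f i))" for f :: "nat \<Rightarrow> real"
  have U: "U \<in> carrier_mat n n" by (simp add: U_def)
  have V: "V \<in> carrier_mat n n" using U by (simp add: V_def)
  have D: "D f \<in> carrier_mat n n" for f by (simp add: D_def)
  have Ui: "U $$ (x, i) = u i x" if "i < n" "x < n" for i x using that by (simp add: U_def)
  have Vi: "V $$ (i, x) = cnj (u i x)" if "i < n" "x < n" for i x
    unfolding V_def mat_adjoint_index[OF U that] using that by (simp add: Ui)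
  note as = assoc_mult_mat[of _ n n _ n _ n] mult_carrier_mat[of _ n n _ n]
  have VU: "V * U = 1\<^sub>m n"
  proof (rule eq_matI)
    fix i j assume "i < dim_row (1\<^sub>m n :: complex mat)" "j < dim_col (1\<^sub>m n :: complex mat)"
    then have ij: "i < n" "j < n" by auto
    have "(V * U) $$ (i, j) = ip n (u i) (u j)"
      using ij U V by (simp add: scalar_prod_def ip_def Vi U_def atLeast0LessThan)
    then show "(V * U) $$ (i, j) = 1\<^sub>m n $$ (i, j)"
      using eigensystem_orthonormal[OF es ij] ij by simp
  qed (use U V in auto)
  have UV: "U * V = 1\<^sub>m n"
    by (rule mat_mult_left_right_inverse[OF V U VU])
  have AU: "A = U * D l * V"
  proof (rule eq_matI)
    fix x y assume "x < dim_row (U * D l * V)" "y < dim_col (U * D l * V)"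
    then have xy: "x < n" "y < n" using U V by auto
    have "(U * D l * V) $$ (x, y) = (\<Sum>i<n. u i x * complex_of_real (l i) * cnj (u i y))"
      using xy V by (simp add: D_def mat_diag_mult_right[OF U] scalar_prod_def Vi Ui atLeast0LessThan)
    then show "A $$ (x, y) = (U * D l * V) $$ (x, y)"
      using es xy by (simp add: eigensystem_def mult_ac)
  qed (use A U V in auto)
  have "diagonalizes U l A"
    using A U UV VU AU unfolding diagonalizes_def V_def D_def by auto
  then have log: "mat_log2 A = U * D (\<lambda>i. log 2 (l i)) * V"
    unfolding mat_log2_def using mat_fun_eqI A by (auto simp: D_def V_def)
  have "A * mat_log2 A = U * D l * ((V * U) * (D (\<lambda>i. log 2 (l i)) * V))"
    unfolding log using U V D by (subst (1) AU) (simp add: as)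
  also have "\<dots> = U * (D l * D (\<lambda>i. log 2 (l i)) * V)"
    unfolding VU using U V D by (simp add: as left_mult_one_mat[of _ n n])
  finally have "mat_trace (A * mat_log2 A) = mat_trace (D l * D (\<lambda>i. log 2 (l i)) * V * U)"
    using mat_trace_mult_commute[of U n "D l * D (\<lambda>i. log 2 (l i)) * V"] U V D by (simp add: as)
  also have "D l * D (\<lambda>i. log 2 (l i)) * V * U = D l * D (\<lambda>i. log 2 (l i))"
    using U V D VU by (simp add: as right_mult_one_mat[of _ n n])
  also have "mat_trace (D l * D (\<lambda>i. log 2 (l i))) = complex_of_real (\<Sum>i<n. l i * log 2 (l i))"
    unfolding D_def mat_diag_diag by (simp add: mat_trace_def mat_diag_def)
  finally show ?thesis by (simp add: vn_entropy_def)
qed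

lemma vn_entropy_dephasing:
  assumes A: "psd n A"
  shows "vn_entropy (dephasing A) = - (\<Sum>x<n. Re (A $$ (x, x)) * log 2 (Re (A $$ (x, x))))"
proof -
  define p where "p x = Re (A $$ (x, x))" for x
  have dim: "dim_row A = n" using A by (auto simp: psd_def)
  have "A $$ (x, x) = complex_of_real (p x)" if "x < n" for x
    using psd_diag_nonneg[OF A that] by (simp add: p_def less_eq_complex_def complex_eq_iff)
  then have D: "dephasing A = mat_diag n (\<lambda>x. complex_of_real (p x))"
    unfolding dephasing_def dim by (intro eq_matI) (auto simp: mat_diag_def)
  have log: "mat_log2 (dephasing A) = mat_diag n (\<lambda>x. complex_of_real (log 2 (p x)))"
    by (simp add: mat_log2_def D mat_fun_diag)
  show ?thesis
    unfolding vn_entropy_def log unfolding D mat_diag_diag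
    by (simp add: mat_trace_def mat_diag_def p_def)
qed

text \<open>Dividing by \<open>ln 2\<close> links the definition in base 2 to the estimates in
  natural logarithms.\<close>

lemma rel_ent_coherence_eigensystem:
  assumes A: "A \<in> states n" and es: "eigensystem n A l u"
  shows "rel_ent_coherence A = ereal (((\<Sum>i<n. l i * ln (l i))
    - (\<Sum>x<n. Re (A $$ (x, x)) * ln (Re (A $$ (x, x))))) / ln 2)"
proof -
  have "psd n A" "A \<in> carrier_mat n n" using A by (auto simp: states_def psd_def)
  then show ?thesis
    unfolding rel_ent_coherence_eq[OF A]
    by (simp add: vn_entropy_dephasing vn_entropy_eigensystem[OF _ es] log_def
        diff_divide_distrib sum_divide_distrib)
qed

section \<open>Comparing the coherence of a state with that of its reduction\<close>

lemma states_eigensystem: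
  assumes "A \<in> states n"
  obtains l u where "eigensystem n A l u"
  using that psd_eigensystem assms unfolding states_def by blast

lemma ptrace_states:
  assumes "A \<in> states (d * k)"
  shows "ptrace d k A \<in> states k"
proof -
  have "A \<in> carrier_mat (d * k) (d * k)" using assms by (simp add: states_def psd_def)
  then show ?thesis using assms by (simp add: states_def ptrace_psd ptrace_trace)
qed

lemma rel_ent_coherence_ptrace_le:
  assumes A: "A \<in> states (d * k)"
  shows "rel_ent_coherence (ptrace d k A) \<le> rel_ent_coherence A"
proof -
  have B: "ptrace d k A \<in> states k" by (rule ptrace_states[OF A])
  obtain l u where es: "eigensystem (d * k) A l u" using states_eigensystem[OF A] .
  obtain m v where eb: "eigensystem k (ptrace d k A) m v" using states_eigensystem[OF B] .
  show ?thesis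
    unfolding rel_ent_coherence_eigensystem[OF A es] rel_ent_coherence_eigensystem[OF B eb]
    using coherence_sum_ptrace_le[OF es eb] by (simp add: divide_right_mono)
qed

text \<open>Gibbs inequality for \<open>p\<close> against \<open>q b / d\<close>, the distribution
  with the same second marginal and a uniform conditional one.\<close>

lemma conditional_entropy_le_ln:
  fixes p :: "nat \<Rightarrow> nat \<Rightarrow> real"
  assumes "1 \<le> d" and p0: "\<And>a b. a < d \<Longrightarrow> b < k \<Longrightarrow> 0 \<le> p a b"
    and q: "\<And>b. b < k \<Longrightarrow> q b = (\<Sum>a<d. p a b)" and total: "(\<Sum>b<k. q b) = 1"
  shows "(\<Sum>b<k. q b * ln (q b)) - (\<Sum>a<d. \<Sum>b<k. p a b * ln (p a b)) \<le> ln (real d)"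
proof -
  have p1: "(\<Sum>a<d. \<Sum>b<k. p a b) = 1" using total by (subst sum.swap) (simp add: q)
  have q0: "0 \<le> q b" if "b < k" for b using that p0 by (auto simp: q intro!: sum_nonneg)
  have "p a b - q b / real d \<le> p a b * ln (p a b) - p a b * ln (q b) + p a b * ln (real d)"
    if ab: "a < d" "b < k" for a b
  proof (cases "p a b = 0")
    case False
    have "p a b \<le> q b" unfolding q[OF ab(2)] using p0 ab by (intro member_le_sum) auto
    then have pos: "0 < p a b" "0 < q b" using False p0[OF ab] by auto
    have "p a b - q b / real d \<le> p a b * ln (p a b) - p a b * ln (q b / real d)"
      using gibbs_term[of "p a b" "q b / real d"] pos assms(1)
      by (simp add: log_def diff_divide_distrib[symmetric] divide_le_cancel)
    then show ?thesis using pos assms(1) by (simp add: ln_div algebra_simps)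
  qed (use q0[OF ab(2)] in simp)
  then have "(\<Sum>a<d. \<Sum>b<k. p a b - q b / real d)
      \<le> (\<Sum>a<d. \<Sum>b<k. p a b * ln (p a b) - p a b * ln (q b) + p a b * ln (real d))"
    by (intro sum_mono) auto
  also have "\<dots> = (\<Sum>a<d. \<Sum>b<k. p a b * ln (p a b)) - (\<Sum>a<d. \<Sum>b<k. p a b * ln (q b))
      + (\<Sum>a<d. \<Sum>b<k. p a b) * ln (real d)"
    by (simp add: sum.distrib sum_subtractf sum_distrib_right)
  also have "(\<Sum>a<d. \<Sum>b<k. p a b * ln (q b)) = (\<Sum>b<k. q b * ln (q b))"
    by (subst sum.swap) (simp add: q sum_distrib_right)
  also have "(\<Sum>a<d. \<Sum>b<k. p a b - q b / real d) = 0"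
    using p1 total assms(1) by (simp add: sum_subtractf flip: sum_divide_distrib)
  finally show ?thesis using p1 by simp
qed

text \<open>The difference of the coherences is \<open>H(A|B) - S(A|B)\<close>:
  \<open>conditional_entropy_le_ln\<close> bounds the classical term by \<open>log d\<close>, and
  \<open>entropy_sum_ptrace_le\<close> bounds \<open>- S(A|B)\<close> by
  \<open>log c\<close>.\<close>

lemma rel_ent_coherence_le_ptrace:
  assumes "1 \<le> d" and A: "A \<in> states (d * k)" and dom: "reduction_dominated d k c A" and c: "0 < c"
  shows "rel_ent_coherence A \<le> rel_ent_coherence (ptrace d k A) + ereal (log 2 (real d) + log 2 c)"
proof -
  have B: "ptrace d k A \<in> states k" by (rule ptrace_states[OF A])
  have psd: "psd (d * k) A" and cA: "A \<in> carrier_mat (d * k) (d * k)"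
    using A by (auto simp: states_def psd_def)
  obtain l u where es: "eigensystem (d * k) A l u" using psd_eigensystem[OF psd] .
  obtain m v where eb: "eigensystem k (ptrace d k A) m v" using states_eigensystem[OF B] .
  have total: "(\<Sum>i<d * k. l i) = 1"
    using eigensystem_trace[OF es cA] A by (simp add: states_def)
  define p where "p a b = Re (A $$ (a * k + b, a * k + b))" for a b
  define q where "q b = Re (ptrace d k A $$ (b, b))" for b
  have "(\<Sum>b<k. q b * ln (q b)) - (\<Sum>a<d. \<Sum>b<k. p a b * ln (p a b)) \<le> ln (real d)"
  proof (rule conditional_entropy_le_ln[OF assms(1)])
    show "0 \<le> p a b" if "a < d" "b < k" for a b
      using psd_diag_nonneg[OF psd block_index_less[OF that]] by (simp add: p_def less_eq_complex_def)
    show "q b = (\<Sum>a<d. p a b)" if "b < k" for b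
      using that by (simp add: p_def q_def ptrace_diag)
    have "Re (mat_trace (ptrace d k A)) = 1" using B by (simp add: states_def)
    then show "(\<Sum>b<k. q b) = 1" by (simp add: mat_trace_def q_def ptrace_def)
  qed
  moreover have "(\<Sum>a<d. \<Sum>b<k. p a b * ln (p a b))
      = (\<Sum>x<d * k. Re (A $$ (x, x)) * ln (Re (A $$ (x, x))))"
    by (simp add: sum_over_blocks p_def)
  ultimately have "(\<Sum>i<d * k. l i * ln (l i)) - (\<Sum>x<d * k. Re (A $$ (x, x)) * ln (Re (A $$ (x, x))))
      \<le> ((\<Sum>j<k. m j * ln (m j)) - (\<Sum>b<k. q b * ln (q b))) + (ln (real d) + ln c)"
    using entropy_sum_ptrace_le[OF es eb dom c total] by linarith
  then have "((\<Sum>i<d * k. l i * ln (l i)) - (\<Sum>x<d * k. Re (A $$ (x, x)) * ln (Re (A $$ (x, x))))) / ln 2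
      \<le> (((\<Sum>j<k. m j * ln (m j)) - (\<Sum>b<k. q b * ln (q b))) + (ln (real d) + ln c)) / ln 2"
    by (rule divide_right_mono) simp
  then show ?thesis
    unfolding rel_ent_coherence_eigensystem[OF A es] rel_ent_coherence_eigensystem[OF B eb] q_def
    by (simp add: log_def add_divide_distrib)
qed

text \<open>Each entry of the reduced matrix is the trace of one of the \<open>d\<close>-dimensional
  slices on which \<open>\<Phi>\<close> acts.\<close>

lemma ptrace_ext_id:
  assumes "linear_on_mats d \<Phi>" "trace_preserving d \<Phi>" and A: "A \<in> carrier_mat (d * k) (d * k)"
  shows "ptrace d k (ext_id d k \<Phi> A) = ptrace d k A"
proof (rule eq_matI)
  fix r s assume "r < dim_row (ptrace d k A)" "s < dim_col (ptrace d k A)"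
  then have rs: "r < k" "s < k" by (auto simp: ptrace_def)
  define M where "M = mat d d (\<lambda>(i, j). A $$ (i * k + r, j * k + s))"
  have M: "M \<in> carrier_mat d d" by (simp add: M_def)
  then have PM: "\<Phi> M \<in> carrier_mat d d" using assms(1) by (simp add: linear_on_mats_def)
  have "ptrace d k (ext_id d k \<Phi> A) $$ (r, s) = (\<Sum>a<d. \<Phi> M $$ (a, a))"
    using rs by (simp add: ptrace_def ext_id_def block_index_less M_def)
  also have "\<dots> = mat_trace (\<Phi> M)" using PM by (simp add: mat_trace_def)
  also have "\<dots> = mat_trace M" using assms(2) M by (simp add: trace_preserving_def)
  also have "\<dots> = ptrace d k A $$ (r, s)"
    using rs by (simp add: mat_trace_def M_def ptrace_def)
  finally show "ptrace d k (ext_id d k \<Phi> A) $$ (r, s) = ptrace d k A $$ (r, s)" .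
qed (auto simp: ptrace_def)

lemma ext_id_states:
  assumes \<Phi>: "quantum_channel d \<Phi>" and "1 \<le> k" and A: "A \<in> states (d * k)"
  shows "ext_id d k \<Phi> A \<in> states (d * k)"
proof -
  have cA: "A \<in> carrier_mat (d * k) (d * k)" using A by (simp add: states_def psd_def)
  have psd: "psd (d * k) (ext_id d k \<Phi> A)"
    using assms by (auto simp: quantum_channel_def completely_positive_def states_def)
  \<comment> \<open>The trace is read off the reduced matrix, which the channel leaves
    unchanged.\<close>
  have "mat_trace (ext_id d k \<Phi> A) = mat_trace (ptrace d k (ext_id d k \<Phi> A))"
    using psd by (simp add: ptrace_trace psd_def)
  also have "\<dots> = mat_trace A"
    using \<Phi> cA by (simp add: ptrace_ext_id ptrace_trace quantum_channel_def)
  finally show ?thesis using psd A by (simp add: states_def)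
qed

text \<open>The final coherence is bounded below and the initial one above through the same reduced
  state, whose coherence then cancels.\<close>

lemma coherence_loss_le:
  assumes d: "1 \<le> d" and k: "1 \<le> k" and \<Phi>: "quantum_channel d \<Phi>" and A: "A \<in> states (d * k)"
    and dom: "reduction_dominated d k c A" and c: "0 < c"
  shows "coherence_loss d k \<Phi> A \<le> ereal (log 2 (real d) + log 2 c)"
proof -
  have cA: "A \<in> carrier_mat (d * k) (d * k)" using A by (simp add: states_def psd_def)
  have E: "ext_id d k \<Phi> A \<in> states (d * k)" by (rule ext_id_states[OF \<Phi> k A])
  have "rel_ent_coherence (ptrace d k A) \<le> rel_ent_coherence (ext_id d k \<Phi> A)"
    using rel_ent_coherence_ptrace_le[OF E] \<Phi> cA by (simp add: ptrace_ext_id quantum_channel_def)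
  then show ?thesis
    using rel_ent_coherence_le_ptrace[OF d A dom c]
    \<comment> \<open>The closed form shows all three coherences to be real, so the extended
      arithmetic becomes real arithmetic.\<close>
    unfolding coherence_loss_def rel_ent_coherence_eq[OF A] rel_ent_coherence_eq[OF E]
      rel_ent_coherence_eq[OF ptrace_states[OF A]]
    by simp
qed

section \<open>Separable states\<close>

lemma tensor_mat_block:
  assumes "R \<in> carrier_mat d d" "T \<in> carrier_mat k k" "a < d" "a' < d" "b < k" "b' < k"
  shows "tensor_mat R T $$ (a * k + b, a' * k + b') = R $$ (a, a') * T $$ (b, b')"
  using assms by (simp add: tensor_mat_def block_index_less)

lemma tensor_mat_carrier:
  "R \<in> carrier_mat d d \<Longrightarrow> T \<in> carrier_mat k k \<Longrightarrow> tensor_mat R T \<in> carrier_mat (d * k) (d * k)"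
  by (simp add: tensor_mat_def)

lemma ptrace_tensor_mat:
  assumes "R \<in> carrier_mat d d" "T \<in> carrier_mat k k"
  shows "ptrace d k (tensor_mat R T) = mat_trace R \<cdot>\<^sub>m T"
  using assms
  by (intro eq_matI) (auto simp: ptrace_def tensor_mat_block mat_trace_def sum_distrib_right)

text \<open>Only \<open>T\<close> is diagonalised: contracting \<open>f\<close> with each
  \<open>h j\<close> leaves a vector of the first system on which \<open>R\<close> acts. Positivity
  and domination of product states both come from this.\<close>

lemma tensor_mat_form:
  assumes R: "R \<in> carrier_mat d d" and T: "T \<in> carrier_mat k k" and et: "eigensystem k T t h"
  shows "ip (d * k) f (mat_app (d * k) (tensor_mat R T) f)
    = (\<Sum>j<k. complex_of_real (t j) *
        ip d (\<lambda>a. ip k (h j) (block k a f)) (mat_app d R (\<lambda>a. ip k (h j) (block k a f))))"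
proof -
  let ?\<phi> = "\<lambda>j a. ip k (h j) (block k a f)"
  have "ip (d * k) f (mat_app (d * k) (tensor_mat R T) f)
      = (\<Sum>a<d. \<Sum>b<k. \<Sum>a'<d. \<Sum>b'<k. R $$ (a, a') * (T $$ (b, b') * block k a' f b' * cnj (block k a f b)))"
    unfolding ip_mat_app sum_over_blocks using R T
    by (intro sum.cong refl) (simp add: tensor_mat_block block_def)
  also have "\<dots> = (\<Sum>a<d. \<Sum>a'<d. \<Sum>b<k. \<Sum>b'<k. R $$ (a, a') * (T $$ (b, b') * block k a' f b' * cnj (block k a f b)))"
    by (intro sum.cong refl sum.swap)
  also have "\<dots> = (\<Sum>a<d. \<Sum>a'<d. R $$ (a, a') * ip k (block k a f) (mat_app k T (block k a' f)))"
    unfolding ip_mat_app sum_distrib_left ..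
  also have "\<dots> = (\<Sum>a<d. \<Sum>a'<d. \<Sum>j<k. complex_of_real (t j) * (R $$ (a, a') * ?\<phi> j a' * cnj (?\<phi> j a)))"
    unfolding eigensystem_form[OF et] sum_distrib_left cnj_ip
    by (intro sum.cong refl) (simp add: mult_ac)
  also have "\<dots> = (\<Sum>a<d. \<Sum>j<k. \<Sum>a'<d. complex_of_real (t j) * (R $$ (a, a') * ?\<phi> j a' * cnj (?\<phi> j a)))"
    by (intro sum.cong refl sum.swap)
  also have "\<dots> = (\<Sum>j<k. \<Sum>a<d. \<Sum>a'<d. complex_of_real (t j) * (R $$ (a, a') * ?\<phi> j a' * cnj (?\<phi> j a)))"
    by (rule sum.swap)
  finally show ?thesis unfolding ip_mat_app sum_distrib_left .
qed

text \<open>The eigenvalues of a state form a probability distribution, so \<open>R \<le> 1\<close>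
  follows by averaging the Cauchy-Schwarz bound.\<close>

lemma state_quadratic_form_le:
  assumes R: "R \<in> states n"
  shows "Re (ip n f (mat_app n R f)) \<le> (\<Sum>x<n. (cmod (f x))\<^sup>2)"
proof -
  have cR: "psd n R" "R \<in> carrier_mat n n" using R by (auto simp: states_def psd_def)
  obtain l u where es: "eigensystem n R l u" using psd_eigensystem[OF cR(1)] .
  have "Re (ip n f (mat_app n R f)) \<le> (\<Sum>i<n. l i * (\<Sum>x<n. (cmod (f x))\<^sup>2))"
    unfolding eigensystem_quadratic_form[OF es]
    by (intro sum_mono mult_left_mono unit_ip_le_norm)
      (auto simp: eigensystem_nonneg[OF es] eigensystem_orthonormal[OF es])
  also have "\<dots> = (\<Sum>x<n. (cmod (f x))\<^sup>2)"
    using eigensystem_trace[OF es cR(2)] R by (simp add: states_def flip: sum_distrib_right)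
  finally show ?thesis .
qed

lemma tensor_mat_psd:
  assumes "psd d R" "psd k T"
  shows "psd (d * k) (tensor_mat R T)"
proof (rule psdI)
  fix f
  have c: "R \<in> carrier_mat d d" "T \<in> carrier_mat k k" using assms by (auto simp: psd_def)
  obtain t h where et: "eigensystem k T t h" using psd_eigensystem[OF assms(2)] .
  show "0 \<le> ip (d * k) f (mat_app (d * k) (tensor_mat R T) f)"
    unfolding tensor_mat_form[OF c et]
    by (intro sum_nonneg mult_nonneg_nonneg psd_ip_mat_app[OF assms(1)])
      (simp add: eigensystem_nonneg[OF et] less_eq_complex_def)
qed (use assms in \<open>auto simp: psd_def intro!: tensor_mat_carrier\<close>)

lemma tensor_mat_states:
  assumes "R \<in> states d" "T \<in> states k"
  shows "tensor_mat R T \<in> states (d * k)"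
proof -
  have c: "R \<in> carrier_mat d d" "T \<in> carrier_mat k k" using assms by (auto simp: states_def psd_def)
  have "mat_trace (tensor_mat R T) = mat_trace (ptrace d k (tensor_mat R T))"
    using c by (simp add: ptrace_trace tensor_mat_carrier)
  also have "\<dots> = 1" using assms c by (simp add: ptrace_tensor_mat states_def mat_trace_def)
  finally show ?thesis using assms by (simp add: states_def tensor_mat_psd)
qed

text \<open>The reduced state is \<open>T\<close> itself, and \<open>R \<le> 1\<close> gives
  \<open>R tensor T \<le> 1 tensor T\<close>.\<close>

lemma tensor_mat_reduction_dominated:
  assumes R: "R \<in> states d" and T: "T \<in> states k"
  shows "reduction_dominated d k 1 (tensor_mat R T)"
  unfolding reduction_dominated_def
proof
  fix f
  have c: "R \<in> carrier_mat d d" "T \<in> carrier_mat k k" "psd k T" "mat_trace R = 1"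
    using assms by (auto simp: states_def psd_def)
  obtain t h where et: "eigensystem k T t h" using psd_eigensystem[OF c(3)] .
  have pt: "ptrace d k (tensor_mat R T) = T"
    using c by (simp add: ptrace_tensor_mat) (intro eq_matI, auto)
  have "Re (ip (d * k) f (mat_app (d * k) (tensor_mat R T) f))
      \<le> (\<Sum>j<k. t j * (\<Sum>a<d. (cmod (ip k (h j) (block k a f)))\<^sup>2))"
    unfolding tensor_mat_form[OF c(1,2) et] Re_sum
    by (intro sum_mono)
      (simp add: eigensystem_nonneg[OF et] mult_left_mono state_quadratic_form_le[OF R])
  also have "\<dots> = (\<Sum>a<d. \<Sum>j<k. t j * (cmod (ip k (h j) (block k a f)))\<^sup>2)"
    unfolding sum_distrib_left by (rule sum.swap)
  finally show "Re (ip (d * k) f (mat_app (d * k) (tensor_mat R T) f))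
      \<le> 1 * (\<Sum>a<d. Re (ip k (block k a f) (mat_app k (ptrace d k (tensor_mat R T)) (block k a f))))"
    by (simp add: pt eigensystem_quadratic_form[OF et])
qed

lemma ip_mat_app_combination:
  assumes "\<And>x y. x < n \<Longrightarrow> y < n \<Longrightarrow> A $$ (x, y) = (\<Sum>l\<in>I. c l * B l $$ (x, y))"
  shows "ip n f (mat_app n A g) = (\<Sum>l\<in>I. c l * ip n f (mat_app n (B l) g))"
proof -
  have "ip n f (mat_app n A g) = (\<Sum>x<n. \<Sum>y<n. \<Sum>l\<in>I. c l * (B l $$ (x, y) * g y * cnj (f x)))"
    unfolding ip_mat_app using assms
    by (intro sum.cong refl) (simp add: sum_distrib_right mult.assoc)
  also have "\<dots> = (\<Sum>x<n. \<Sum>l\<in>I. \<Sum>y<n. c l * (B l $$ (x, y) * g y * cnj (f x)))"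
    by (intro sum.cong refl sum.swap)
  also have "\<dots> = (\<Sum>l\<in>I. \<Sum>x<n. \<Sum>y<n. c l * (B l $$ (x, y) * g y * cnj (f x)))"
    by (rule sum.swap)
  finally show ?thesis unfolding ip_mat_app sum_distrib_left .
qed

text \<open>Both sides of the domination are linear in the matrix, so the product case extends to
  mixtures with nonnegative weights.\<close>

lemma separable_states_dominated:
  assumes "A \<in> separable_states d k"
  shows "A \<in> states (d * k)" and "reduction_dominated d k 1 A"
proof -
  obtain n :: nat and p R T where
    lt: "\<forall>l<n. 0 \<le> p l \<and> R l \<in> states d \<and> T l \<in> states k" and p1: "(\<Sum>l<n. p l) = 1"
    and A: "A = mat (d * k) (d * k) (\<lambda>ij. \<Sum>l<n. complex_of_real (p l) * tensor_mat (R l) (T l) $$ ij)"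
    using assms unfolding separable_states_def by blast
  define B where "B l = tensor_mat (R l) (T l)" for l
  have p: "0 \<le> p l" and B: "B l \<in> states (d * k)" and domB: "reduction_dominated d k 1 (B l)"
    if "l < n" for l
    using lt that by (auto simp: B_def tensor_mat_states tensor_mat_reduction_dominated)
  have Bc: "dim_row (B l) = d * k" if "l < n" for l
    using B[OF that] by (auto simp: states_def psd_def)
  have form: "ip (d * k) f (mat_app (d * k) A f) = (\<Sum>l<n. complex_of_real (p l) * ip (d * k) f (mat_app (d * k) (B l) f))" for f
    by (rule ip_mat_app_combination) (simp add: A B_def)
  have pform: "ip k f (mat_app k (ptrace d k A) f)
      = (\<Sum>l<n. complex_of_real (p l) * ip k f (mat_app k (ptrace d k (B l)) f))" for f
  proof (rule ip_mat_app_combination)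
    fix x y assume "x < k" "y < k"
    then show "ptrace d k A $$ (x, y) = (\<Sum>l<n. complex_of_real (p l) * ptrace d k (B l) $$ (x, y))"
      by (simp add: ptrace_def A B_def block_index_less sum_distrib_left) (rule sum.swap)
  qed
  have "psd (d * k) A"
  proof (rule psdI)
    fix f
    show "0 \<le> ip (d * k) f (mat_app (d * k) A f)"
      unfolding form using B p
      by (intro sum_nonneg mult_nonneg_nonneg psd_ip_mat_app) (auto simp: states_def less_eq_complex_def)
  qed (simp add: A)
  moreover have "mat_trace A = 1"
  proof -
    have "mat_trace A = (\<Sum>l<n. \<Sum>x<d * k. complex_of_real (p l) * B l $$ (x, x))"
      unfolding mat_trace_def by (simp add: A B_def) (rule sum.swap)
    also have "\<dots> = (\<Sum>l<n. complex_of_real (p l) * mat_trace (B l))"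
      by (intro sum.cong refl) (simp add: mat_trace_def Bc sum_distrib_left)
    also have "\<dots> = complex_of_real (\<Sum>l<n. p l)"
      using B by (simp add: states_def)
    finally show ?thesis using p1 by simp
  qed
  ultimately show "A \<in> states (d * k)" by (simp add: states_def)
  show "reduction_dominated d k 1 A"
    unfolding reduction_dominated_def
  proof
    fix f
    have "Re (ip (d * k) f (mat_app (d * k) A f))
        \<le> (\<Sum>l<n. p l * (\<Sum>a<d. Re (ip k (block k a f) (mat_app k (ptrace d k (B l)) (block k a f)))))"
      unfolding form Re_sum using p domB
      by (intro sum_mono) (simp add: reduction_dominated_def mult_left_mono)
    also have "\<dots> = (\<Sum>a<d. \<Sum>l<n. p l * Re (ip k (block k a f) (mat_app k (ptrace d k (B l)) (block k a f))))"
      unfolding sum_distrib_left by (rule sum.swap)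
    finally show "Re (ip (d * k) f (mat_app (d * k) A f))
        \<le> 1 * (\<Sum>a<d. Re (ip k (block k a f) (mat_app k (ptrace d k A) (block k a f))))"
      by (simp add: pform)
  qed
qed

section \<open>The two bounds, from the domination constants \<open>d\<close> and 1\<close>

theorem lemma2:
  fixes d :: nat and \<Phi> :: "complex mat \<Rightarrow> complex mat"
  assumes "d \<ge> 1" and "quantum_channel d \<Phi>"
  shows "complete_decohering_power d \<Phi> \<le> ereal (2 * log 2 (real d))
    \<and> (SUP k \<in> {1..}. SUP \<rho> \<in> separable_states d k. coherence_loss d k \<Phi> \<rho>) \<le> ereal (log 2 (real d))"
proof
  show "complete_decohering_power d \<Phi> \<le> ereal (2 * log 2 (real d))"
    unfolding complete_decohering_power_def
  proof (intro SUP_least)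
    fix k \<rho> assume "k \<in> {1::nat..}" and \<rho>: "\<rho> \<in> states (d * k)"
    then have "coherence_loss d k \<Phi> \<rho> \<le> ereal (log 2 (real d) + log 2 (real d))"
      using assms by (intro coherence_loss_le psd_reduction_dominated) (auto simp: states_def)
    then show "coherence_loss d k \<Phi> \<rho> \<le> ereal (2 * log 2 (real d))" by simp
  qed
  show "(SUP k \<in> {1..}. SUP \<rho> \<in> separable_states d k. coherence_loss d k \<Phi> \<rho>) \<le> ereal (log 2 (real d))"
  proof (intro SUP_least)
    fix k \<rho> assume "k \<in> {1::nat..}" and \<rho>: "\<rho> \<in> separable_states d k"
    \<comment> \<open>With \<open>c = 1\<close> the quantum conditional entropy is nonnegative, and
      only the classical \<open>log d\<close> remains.\<close>
    then have "coherence_loss d k \<Phi> \<rho> \<le> ereal (log 2 (real d) + log 2 1)"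
      using assms by (intro coherence_loss_le separable_states_dominated[OF \<rho>]) auto
    then show "coherence_loss d k \<Phi> \<rho> \<le> ereal (log 2 (real d))" by simp
  qed
qed

end
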